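(* There exists a family of unsatisfiable CNF formulas $\tau'_n$ such that the size of the shortest SRC-I proof of $\tau'_n$ is polynomial, but the size of the shortest SR-II proof of $\tau'_n$ is exponential.
   Context: The size of a proof is its number of steps; "polynomial" means $\mathcal{O}(\mathrm{poly}(n))$ and "exponential" means $2^{\Omega(n)}$ (the paper's convention for exponential separations). A clause is a disjunction (set) of literals. A symmetry is a bijection $\phi$ of literals onto literals with $\phi(\lnot x)=\lnot\phi(x)$; it acts on clauses literal by literal. It is positive if it maps variables to variables (without negation). An SRC-I proof (Resolution with global complementary symmetries) of an unsatisfiable CNF is a sequence of clauses ending with the empty clause, each of which is an input clause, or is obtained from earlier clauses by the resolution rule (from $A\lor x$ and $B\lor\lnot x$ infer $A\lor B$), or is obtained by the symmetry rule: if a clause $A$ was inferred earlier in the proof from $B_1,\dots,B_l$, and $\phi$ is a symmetry such that both sets $\{B_i\}$ and $\{\phi(B_i)\}$ are equal to the set of all input clauses, infer $\phi(A)$ in one step. In SR-II (local positive symmetries) the symmetry rule requires instead that all $B_i$ and all $\phi(B_i)$ be input clauses and that $\phi$ be positive. There is no weakening rule. *)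

theory Defs
  imports Complex_Main "HOL-Library.Extended_Nat" "HOL-Library.Extended_Real"
begin

datatype 'a lit = Pos 'a | Neg 'a

fun neg :: "'a lit \<Rightarrow> 'a lit" where
  "neg (Pos x) = Neg x"
| "neg (Neg x) = Pos x"

type_synonym 'a clause = "'a lit set"
type_synonym 'a cnf = "'a clause set"

definition is_cnf :: "'a cnf \<Rightarrow> bool" where
  "is_cnf F \<longleftrightarrow> finite F \<and> (\<forall>C\<in>F. finite C)"

fun lit_true :: "('a \<Rightarrow> bool) \<Rightarrow> 'a lit \<Rightarrow> bool" where
  "lit_true v (Pos x) \<longleftrightarrow> v x"
| "lit_true v (Neg x) \<longleftrightarrow> \<not> v x"

definition satisfies :: "('a \<Rightarrow> bool) \<Rightarrow> 'a cnf \<Rightarrow> bool" where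
  "satisfies v F \<longleftrightarrow> (\<forall>C\<in>F. \<exists>l\<in>C. lit_true v l)"

definition unsatisfiable :: "'a cnf \<Rightarrow> bool" where
  "unsatisfiable F \<longleftrightarrow> \<not> (\<exists>v. satisfies v F)"

definition is_symmetry :: "('a lit \<Rightarrow> 'a lit) \<Rightarrow> bool" where
  "is_symmetry \<phi> \<longleftrightarrow> bij \<phi> \<and> (\<forall>l. \<phi> (neg l) = neg (\<phi> l))"

definition is_positive :: "('a lit \<Rightarrow> 'a lit) \<Rightarrow> bool" where
  "is_positive \<phi> \<longleftrightarrow> (\<forall>x. \<exists>y. \<phi> (Pos x) = Pos y)"

abbreviation map_clauses :: "('a lit \<Rightarrow> 'a lit) \<Rightarrow> 'a cnf \<Rightarrow> 'a cnf" where
  "map_clauses \<phi> B \<equiv> (\<lambda>C. \<phi> ` C) ` B"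

text \<open>
  A symmetry rule is given by its side condition on the input formula, the premises
  B1, ..., Bl (as a set), and the symmetry.
\<close>

type_synonym 'a sym_cond = "'a cnf \<Rightarrow> 'a cnf \<Rightarrow> ('a lit \<Rightarrow> 'a lit) \<Rightarrow> bool"

definition SRC_I :: "'a sym_cond" where
  "SRC_I F B \<phi> \<longleftrightarrow> is_symmetry \<phi> \<and> B = F \<and> map_clauses \<phi> B = F"

definition SR_II :: "'a sym_cond" where
  "SR_II F B \<phi> \<longleftrightarrow> is_symmetry \<phi> \<and> is_positive \<phi> \<and> B \<subseteq> F \<and> map_clauses \<phi> B \<subseteq> F"

text \<open>
  \<open>inferred R F cs i S\<close>: the \<open>i\<close>-th clause of the sequence \<open>cs\<close> can be inferred from
  earlier ones, and \<open>S\<close> is the set of input clauses on which this inference ultimately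
  depends. A clause depending on \<open>S\<close> counts as inferred from every \<open>B \<supseteq> S\<close>, so for
  \<open>SRC_I\<close> the symmetry only has to preserve the input formula. The image of a clause
  under \<open>\<phi>\<close> depends on the images of the input clauses, not on the original ones;
  keeping the original ones would make the local rule unsound when iterated.
\<close>

inductive inferred :: "'a sym_cond \<Rightarrow> 'a cnf \<Rightarrow> 'a clause list \<Rightarrow> nat \<Rightarrow> 'a cnf \<Rightarrow> bool"
  for R :: "'a sym_cond" and F :: "'a cnf" and cs :: "'a clause list" where
  input: "\<lbrakk>i < length cs; cs ! i \<in> F\<rbrakk> \<Longrightarrow> inferred R F cs i {cs ! i}"
| resolution:
    "\<lbrakk>i < length cs; j < i; k < i; inferred R F cs j S; inferred R F cs k T;
      Pos x \<in> cs ! j; Neg x \<in> cs ! k;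
      cs ! i = (cs ! j - {Pos x}) \<union> (cs ! k - {Neg x})\<rbrakk>
     \<Longrightarrow> inferred R F cs i (S \<union> T)"
| symmetry:
    "\<lbrakk>i < length cs; j < i; inferred R F cs j S; S \<subseteq> B; R F B \<phi>; cs ! i = \<phi> ` (cs ! j)\<rbrakk>
     \<Longrightarrow> inferred R F cs i (map_clauses \<phi> S)"

definition is_proof :: "'a sym_cond \<Rightarrow> 'a cnf \<Rightarrow> 'a clause list \<Rightarrow> bool" where
  "is_proof R F cs \<longleftrightarrow>
     cs \<noteq> [] \<and> last cs = {} \<and> (\<forall>i < length cs. \<exists>S. inferred R F cs i S)"

text \<open>Infinite if there is no proof.\<close>

definition shortest_proof_size :: "'a sym_cond \<Rightarrow> 'a cnf \<Rightarrow> enat" where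
  "shortest_proof_size R F = (INF cs \<in> {cs. is_proof R F cs}. enat (length cs))"

end

theory Submission
  imports Defs "HOL-Library.Nat_Bijection" "HOL-Combinatorics.Transposition"
begin

text \<open>
  The formulas are pigeonhole formulas in which every hole clause is padded with private variables
  forced to be false by units, and in which the polarity of the variables is chosen so that all
  non-unit clauses differ in their numbers of positive and negative literals. Complementary
  symmetries can undo the polarity, so the symmetries of the pigeonhole formula that permute the
  holes survive and give the usual short proof. A local positive symmetry, in contrast, fixes every
  non-unit clause it is applied to, and hence up to padding literals every clause derived from
  them. \<open>SR_II\<close> proofs are therefore no more powerful than resolution proofs of the pigeonhole
  formula, which are exponentially long by the argument of Beame and Pitassi: a greedily chosen
  partial matching satisfies all wide clauses of a short proof, but every proof for the remaining
  pigeons and holes contains a wide clause.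
\<close>

subsection \<open>Wide clauses in pigeonhole refutations\<close>

text \<open>Signs alone can tell the pigeon clauses apart: \<open>n\<close> literals allow just the
  \<open>n + 1\<close> counts \<open>0..n\<close> that \<open>n + 1\<close> pigeons need. A hole
  clause of two literals allows only three counts, which is why exactly the hole clauses are padded;
  the units make the padding removable by short resolution. The price is that units carry no
  information about their collision, so a local symmetry may move them. A further obstacle is that a
  symmetry fixing a clause as a set may still permute its literals, so a derived clause need not be
  fixed even if all non-unit inputs behind it are. It helps that there is no weakening: every
  literal of a derived clause comes from an input behind it. The set of these inputs is therefore
  tracked along the proof, and a derived clause is compared with its image semantically, on
  assignments that satisfy the units.\<close>

definition critical :: "nat \<Rightarrow> nat \<Rightarrow> (nat \<Rightarrow> nat) \<Rightarrow> bool" where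
  "critical n i f \<longleftrightarrow> i \<le> n \<and> bij_betw f ({..n} - {i}) {..<n}"

text \<open>Pigeon \<open>i\<close> takes over the hole of \<open>k\<close> and the others keep
  theirs, so \<open>(i, f k)\<close> is the only new pair in the graph. The width argument rests on
  this.\<close>

lemma critical_swap:
  assumes "critical n i f" "k \<le> n"
  shows "critical n k (f \<circ> transpose i k)"
proof -
  have "bij_betw (transpose i k) ({..n} - {k}) ({..n} - {i})"
    using assms unfolding critical_def
    by (intro bij_betw_byWitness[where f' = "transpose i k"]) (auto simp: transpose_def)
  then show ?thesis
    using assms unfolding critical_def by (auto intro: bij_betw_trans)
qed

section \<open>Partial matchings and the greedy restriction\<close>

definition matching :: "('a \<times> 'b) set \<Rightarrow> bool" where
  "matching R \<longleftrightarrow> inj_on fst R \<and> inj_on snd R"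

definition remaining :: "nat \<Rightarrow> (nat \<times> nat) set \<Rightarrow> (nat \<times> nat) set" where
  "remaining n R = ({..n} - fst ` R) \<times> ({..<n} - snd ` R)"

lemma finite_remaining: "finite (remaining n R)"
  by (simp add: remaining_def)

lemma card_remaining_le: "card (remaining n R) \<le> (n + 1)\<^sup>2"
proof -
  have "card (remaining n R) \<le> card ({..n} \<times> {..<n})"
    by (rule card_mono) (auto simp: remaining_def)
  also have "\<dots> \<le> (n + 1)\<^sup>2"
    by (simp add: power2_eq_square algebra_simps)
  finally show ?thesis .
qed

lemma remaining_nonempty:
  assumes "matching R" "finite R" "card R < n"
  shows "remaining n R \<noteq> {}"
proof -
  have "card (fst ` R) \<le> card R" "card (snd ` R) \<le> card R"
    using assms by (auto intro: card_image_le)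
  then have "\<not> {..n} \<subseteq> fst ` R" "\<not> {..<n} \<subseteq> snd ` R"
    using assms card_mono[of "fst ` R" "{..n}"] card_mono[of "snd ` R" "{..<n}"] by auto
  then show ?thesis
    unfolding remaining_def by blast
qed

text \<open>Double counting of incidences: an element of \<open>G\<close> lies on average in at
  least a fraction \<open>q\<close> of the sets, so some element does.\<close>

lemma popular_pair:
  fixes M :: "'t \<Rightarrow> 'a set"
  assumes "finite B" "finite G" "G \<noteq> {}"
    and large: "\<And>t. t \<in> B \<Longrightarrow> real (card G) * q \<le> card (M t \<inter> G)"
  shows "\<exists>e\<in>G. q * card B \<le> card {t\<in>B. e \<in> M t}"
proof (rule ccontr)
  assume "\<not> ?thesis"
  then have small: "\<And>e. e \<in> G \<Longrightarrow> real (card {t\<in>B. e \<in> M t}) < q * card B"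
    by (simp add: not_le)
  have "card G * q * card B = (\<Sum>t\<in>B. card G * q)"
    by simp
  also have "\<dots> \<le> (\<Sum>t\<in>B. real (card (M t \<inter> G)))"
    by (intro sum_mono large)
  also have "\<dots> = real (\<Sum>t\<in>B. \<Sum>e\<in>G. if e \<in> M t then 1 else 0)"
    using assms by (simp add: sum.If_cases Int_def conj_commute)
  also have "\<dots> = real (\<Sum>e\<in>G. \<Sum>t\<in>B. if e \<in> M t then 1 else 0)"
    by (subst sum.swap) simp
  also have "\<dots> = (\<Sum>e\<in>G. real (card {t\<in>B. e \<in> M t}))"
    using assms by (simp add: sum.If_cases Int_def)
  also have "\<dots> < (\<Sum>e\<in>G. q * card B)"
    using small assms by (intro sum_strict_mono) auto
  also have "\<dots> = card G * q * card B"
    by simp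
  finally show False by simp
qed

text \<open>A step survives if \<open>R\<close> does not satisfy it and it is still wide on the
  remaining pairs. There are at most \<open>(n + 1)^2\<close> of these, so a survivor contains at
  least an eighth of them, and adding a popular pair to \<open>R\<close> removes an eighth of the
  survivors. Fewer remaining pairs never create new survivors.\<close>

lemma greedy_restriction:
  fixes M :: "'t \<Rightarrow> (nat \<times> nat) set" and n :: nat
  assumes "finite W"
  defines "surv \<equiv> \<lambda>R. {t\<in>W. M t \<inter> R = {} \<and> (real n + 1)\<^sup>2 / 8 \<le> card (M t \<inter> remaining n R)}"
  shows "k \<le> n \<Longrightarrow> \<exists>R. R \<subseteq> {..n} \<times> {..<n} \<and> matching R \<and> card R = k \<and>
           real (card (surv R)) \<le> (7/8) ^ k * card W"
proof (induction k)
  case 0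
  have "card (surv {}) \<le> card W"
    unfolding surv_def using \<open>finite W\<close> by (intro card_mono) auto
  then show ?case
    by (intro exI[of _ "{}"]) (auto simp: matching_def)
next
  case (Suc k)
  then obtain R where R: "R \<subseteq> {..n} \<times> {..<n}" "matching R" "card R = k"
    and bd: "real (card (surv R)) \<le> (7/8) ^ k * card W"
    by auto
  have fR: "finite R"
    using R(1) finite_subset by blast
  have fin: "finite (surv R)"
    unfolding surv_def using \<open>finite W\<close> by auto
  have "real (card (remaining n R)) \<le> (real n + 1)\<^sup>2"
    using of_nat_mono[OF card_remaining_le[of n R], where ?'a = real] by (simp add: add.commute)
  then obtain e where e: "e \<in> remaining n R"
    and pop: "1/8 * card (surv R) \<le> card {t \<in> surv R. e \<in> M t}"
    using popular_pair[of "surv R" "remaining n R" "1/8" M] fin finite_remaining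
      remaining_nonempty[OF R(2) fR] Suc.prems R(3)
    unfolding surv_def by fastforce
  have "surv (insert e R) \<subseteq> surv R - {t \<in> surv R. e \<in> M t}"
  proof
    fix t assume t: "t \<in> surv (insert e R)"
    have "card (M t \<inter> remaining n (insert e R)) \<le> card (M t \<inter> remaining n R)"
      using finite_remaining by (intro card_mono) (auto simp: remaining_def)
    then have "real (card (M t \<inter> remaining n (insert e R))) \<le> card (M t \<inter> remaining n R)"
      by simp
    then show "t \<in> surv R - {t \<in> surv R. e \<in> M t}"
      using t unfolding surv_def by auto
  qed
  then have "card (surv (insert e R)) \<le> card (surv R - {t \<in> surv R. e \<in> M t})"
    using fin by (intro card_mono) auto
  also have "\<dots> = card (surv R) - card {t \<in> surv R. e \<in> M t}"
    using fin by (intro card_Diff_subset) auto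
  finally have "real (card (surv (insert e R))) \<le> 7/8 * card (surv R)"
    using pop card_mono[OF fin, of "{t \<in> surv R. e \<in> M t}"] by fastforce
  also have "\<dots> \<le> (7/8) ^ Suc k * card W"
    using bd by simp
  finally have "real (card (surv (insert e R))) \<le> (7/8) ^ Suc k * card W" .
  moreover have new: "fst e \<notin> fst ` R" "snd e \<notin> snd ` R"
    using e unfolding remaining_def by (simp_all add: mem_Times_iff)
  moreover have "e \<notin> R"
    using new by blast
  moreover have "matching (insert e R)"
    using R(2) new unfolding matching_def by (auto simp del: image_iff)
  moreover have "insert e R \<subseteq> {..n} \<times> {..<n}"
    using e R(1) unfolding remaining_def by auto
  ultimately show ?case
    using fR R(3) by (intro exI[of _ "insert e R"]) auto
qed

section \<open>Wide steps that escape the restriction\<close>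

definition extends :: "(nat \<times> nat) set \<Rightarrow> nat \<Rightarrow> (nat \<Rightarrow> nat) \<Rightarrow> bool" where
  "extends R i f \<longleftrightarrow> (\<forall>(k, j)\<in>R. k \<noteq> i \<and> f k = j)"

lemma critical_extension_exists:
  assumes R: "R \<subseteq> {..n} \<times> {..<n}" "matching R" and i: "i \<le> n" "i \<notin> fst ` R"
  shows "\<exists>f. critical n i f \<and> extends R i f"
proof -
  have fR: "finite R"
    using R(1) finite_subset by blast
  have cards: "card (fst ` R) = card R" "card (snd ` R) = card R"
    using R(2) by (simp_all add: matching_def card_image)
  define A where "A = {..n} - {i} - fst ` R"
  define B where "B = {..<n} - snd ` R"
  have "fst ` R \<subseteq> {..n} - {i}" "snd ` R \<subseteq> {..<n}"
    using R(1) i by auto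
  then have "card A = card B"
    unfolding A_def B_def using fR i cards by (simp add: card_Diff_subset)
  then obtain g where g: "bij_betw g A B"
    using finite_same_card_bij[of A B] unfolding A_def B_def by auto
  define h where "h = snd \<circ> inv_into R fst"
  have hR: "h k = j" if "(k, j) \<in> R" for k j
    using that R(2) inv_into_f_f[of fst R "(k, j)"] unfolding h_def matching_def by auto
  have "bij_betw h (fst ` R) (snd ` R)"
    unfolding h_def using R(2) bij_betw_inv_into[of fst R "fst ` R"]
    by (intro bij_betw_trans[of _ _ R]) (auto simp: bij_betw_def matching_def)
  define f where "f k = (if k \<in> fst ` R then h k else g k)" for k
  have "bij_betw f (fst ` R) (snd ` R)"
    using \<open>bij_betw h _ _\<close> by (subst bij_betw_cong[where g = h]) (auto simp: f_def)
  moreover have "bij_betw f A B"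
    using g by (subst bij_betw_cong[where g = g]) (auto simp: f_def A_def)
  moreover have "snd ` R \<inter> B = {}"
    by (auto simp: B_def)
  ultimately have "bij_betw f (fst ` R \<union> A) (snd ` R \<union> B)"
    by (rule bij_betw_combine)
  moreover have "fst ` R \<union> A = {..n} - {i}" "snd ` R \<union> B = {..<n}"
    unfolding A_def B_def using R(1) i by auto
  ultimately have "critical n i f"
    using i by (simp add: critical_def)
  moreover have "extends R i f"
    unfolding extends_def f_def using hR i by (force simp: image_iff)
  ultimately show ?thesis by blast
qed

text \<open>
  A step \<open>t\<close> is identified with the set \<open>M t\<close> of pigeon-hole pairs each of which satisfies it, so a
  critical assignment falsifies step \<open>t\<close> iff its graph avoids \<open>M t\<close>.
\<close>

definition avoids :: "nat \<Rightarrow> nat \<Rightarrow> (nat \<Rightarrow> nat) \<Rightarrow> (nat \<times> nat) set \<Rightarrow> bool" where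
  "avoids n i f M \<longleftrightarrow> (\<forall>k\<in>{..n} - {i}. (k, f k) \<notin> M)"

text \<open>The measure of a step is the number of pigeons that can be left out by an extension of
  \<open>R\<close> falsifying it. It is at most 1 for an input, subadditive along inferences and
  maximal at the root, so the first step reaching a third of the maximum has at most two thirds of
  it.\<close>

lemma exists_wide_step:
  fixes M :: "nat \<Rightarrow> (nat \<times> nat) set" and L :: nat
  assumes R: "R \<subseteq> {..n} \<times> {..<n}" "matching R" and p: "3 < n + 1 - card R"
    and step: "\<And>t. t < L \<Longrightarrow>
      (\<exists>q. \<forall>i f. critical n i f \<and> avoids n i f (M t) \<longrightarrow> i = q) \<or>
      (\<exists>a<t. \<exists>b<t. \<forall>i f. critical n i f \<and> avoids n i f (M t) \<longrightarrow>
          avoids n i f (M a) \<or> avoids n i f (M b))"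
    and root: "r < L" "M r = {}"
  shows "\<exists>t<L. M t \<inter> R = {} \<and> 2 * (n + 1 - card R)\<^sup>2 \<le> 9 * card (M t \<inter> remaining n R)"
proof -
  define P where "P = {..n} - fst ` R"
  define V where "V t = {i. \<exists>f. critical n i f \<and> extends R i f \<and> avoids n i f (M t)}" for t
  have fR: "finite R"
    using R(1) finite_subset by blast
  have "fst ` R \<subseteq> {..n}"
    using R(1) by auto
  then have cP: "card P = n + 1 - card R"
    using R(2) fR unfolding P_def matching_def by (simp add: card_Diff_subset card_image)
  have VP: "V t \<subseteq> P" for t
    unfolding V_def P_def by (auto simp: critical_def extends_def)
  have fP: "finite P"
    by (simp add: P_def)
  have "V r = P"
    using VP[of r] critical_extension_exists[OF R] root unfolding V_def P_def
    by (auto simp: avoids_def)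
  then have ex: "r < L \<and> card P \<le> 3 * card (V r)"
    using root by simp
  define t where "t = (LEAST t. t < L \<and> card P \<le> 3 * card (V t))"
  have t: "t < L" "card P \<le> 3 * card (V t)"
    using LeastI[of "\<lambda>t. t < L \<and> card P \<le> 3 * card (V t)", OF ex] unfolding t_def by auto
  have below: "3 * card (V a) < card P" if "a < t" for a
    using not_less_Least[of a "\<lambda>t. t < L \<and> card P \<le> 3 * card (V t)"] that t
    unfolding t_def by auto
  have upper: "3 * card (V t) \<le> 2 * card P"
    using step[OF t(1)]
  proof (elim disjE exE conjE)
    fix q assume "\<forall>i f. critical n i f \<and> avoids n i f (M t) \<longrightarrow> i = q"
    then have "V t \<subseteq> {q}"
      by (auto simp: V_def)
    then have "card (V t) \<le> 1"
      using card_mono[of "{q}" "V t"] by simp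
    then show ?thesis
      using p cP by linarith
  next
    fix a b assume ab: "a < t" "b < t"
      and "\<forall>i f. critical n i f \<and> avoids n i f (M t) \<longrightarrow> avoids n i f (M a) \<or> avoids n i f (M b)"
    then have "V t \<subseteq> V a \<union> V b"
      by (auto simp: V_def)
    then have "card (V t) \<le> card (V a \<union> V b)"
      using VP fP by (meson card_mono finite_Un finite_subset)
    also have "\<dots> \<le> card (V a) + card (V b)"
      by (rule card_Un_le)
    finally show ?thesis
      using below[OF ab(1)] below[OF ab(2)] by linarith
  qed
  have "\<forall>i\<in>V t. \<exists>f. critical n i f \<and> extends R i f \<and> avoids n i f (M t)"
    by (simp add: V_def)
  then obtain F where F: "\<And>i. i \<in> V t \<Longrightarrow> critical n i (F i)"
    "\<And>i. i \<in> V t \<Longrightarrow> extends R i (F i)" "\<And>i. i \<in> V t \<Longrightarrow> avoids n i (F i) (M t)"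
    by metis
  \<comment> \<open>Exchanging a pigeon that can be left out with one that cannot must satisfy the
    step, through the one pair that is new.\<close>
  define g where "g = (\<lambda>(i, k). (i, F i k))"
  have inj: "inj_on g (V t \<times> (P - V t))"
  proof (rule inj_onI, clarsimp simp: g_def)
    fix i k k' assume *: "i \<in> V t" "k \<in> P" "k \<notin> V t" "k' \<in> P" "k' \<notin> V t" "F i k = F i k'"
    then show "k = k'"
      using F(1)[OF *(1)] unfolding critical_def bij_betw_def P_def
      by (auto dest!: inj_onD[of "F i" _ k k'])
  qed
  have img: "g ` (V t \<times> (P - V t)) \<subseteq> M t \<inter> remaining n R"
  proof
    fix e assume "e \<in> g ` (V t \<times> (P - V t))"
    then obtain i k where i: "i \<in> V t" and k: "k \<in> P" "k \<notin> V t" and e: "e = (i, F i k)"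
      unfolding g_def by auto
    have ik: "i \<noteq> k" "k \<le> n" "i \<le> n" "i \<in> P"
      using i k VP by (auto simp: P_def)
    define f where "f = F i \<circ> transpose i k"
    have f: "f x = F i x" if "x \<noteq> i" "x \<noteq> k" for x
      using that by (simp add: f_def)
    have crit: "critical n k f"
      using critical_swap[OF F(1)[OF i]] ik by (simp add: f_def)
    have "extends R k f"
      using F(2)[OF i] k(1) f ik(4) unfolding extends_def P_def by (force simp: image_iff)
    then have "\<not> avoids n k f (M t)"
      using crit k unfolding V_def by blast
    then obtain x where x: "x \<le> n" "x \<noteq> k" "(x, f x) \<in> M t"
      unfolding avoids_def by auto
    \<comment> \<open>Away from \<open>i\<close> and \<open>k\<close>, \<open>f\<close> agrees with
      \<open>F i\<close>, which avoids \<open>M t\<close>.\<close>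
    have "x = i"
      using x f[of x] F(3)[OF i] unfolding avoids_def by (metis Diff_iff atMost_iff singletonD)
    then have "(i, F i k) \<in> M t"
      using x by (simp add: f_def)
    moreover have "F i k < n"
      using F(1)[OF i] ik unfolding critical_def bij_betw_def by auto
    moreover have "F i k \<notin> snd ` R"
    proof
      assume "F i k \<in> snd ` R"
      then obtain k' where k': "(k', F i k) \<in> R"
        by (metis imageE prod.collapse)
      then have "k' \<noteq> i" "F i k' = F i k" "k' \<le> n"
        using F(2)[OF i] R(1) unfolding extends_def by auto
      then have "k' = k"
        using F(1)[OF i] ik unfolding critical_def bij_betw_def
        by (auto dest!: inj_onD[of "F i" _ k' k])
      then show False
        using k' k(1) unfolding P_def by (force simp: image_iff)
    qed
    ultimately show "e \<in> M t \<inter> remaining n R"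
      using ik e by (auto simp: remaining_def P_def)
  qed
  have fV: "finite (V t)"
    using VP fP finite_subset by blast
  have "card (V t) * (card P - card (V t)) = card (g ` (V t \<times> (P - V t)))"
    using inj VP fV by (simp add: card_image card_cartesian_product card_Diff_subset)
  also have "\<dots> \<le> card (M t \<inter> remaining n R)"
    using img finite_remaining by (intro card_mono) auto
  finally have le: "card (V t) * (card P - card (V t)) \<le> card (M t \<inter> remaining n R)" .
  have "card (V t) \<le> card P"
    using VP fP card_mono by blast
  then obtain d where d: "card P = card (V t) + d"
    using le_Suc_ex by blast
  have "2 * (card P)\<^sup>2 \<le> 9 * (card (V t) * d)"
  proof -
    define v where "v = int (card (V t))"
    \<comment> \<open>Both factors are nonnegative because \<open>v\<close> lies between one and two
      thirds of \<open>v + d\<close>; expanding the product gives the bound.\<close>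
    have "0 \<le> (2 * v - int d) * (2 * int d - v)"
      using t(2) upper d unfolding v_def by (intro mult_nonneg_nonneg) linarith+
    then have "2 * (v + int d)\<^sup>2 \<le> 9 * (v * int d)"
      by (simp add: power2_eq_square algebra_simps)
    then have "int (2 * (card P)\<^sup>2) \<le> int (9 * (card (V t) * d))"
      by (simp add: v_def d)
    then show ?thesis
      by (simp only: of_nat_le_iff)
  qed
  then have "2 * (n + 1 - card R)\<^sup>2 \<le> 9 * card (M t \<inter> remaining n R)"
    using le d cP by simp
  moreover have "M t \<inter> R = {}"
  proof -
    have "V t \<noteq> {}"
      using t(2) p cP by (intro notI) simp
    then obtain i where i: "i \<in> V t" by blast
    show ?thesis
    proof (clarsimp simp: set_eq_iff)
      fix k j assume "(k, j) \<in> M t" "(k, j) \<in> R"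
      then show False
        using F(2)[OF i] F(3)[OF i] R(1) unfolding extends_def avoids_def by force
    qed
  qed
  ultimately show ?thesis
    using t(1) by blast
qed

text \<open>Only the semantic behaviour of steps enters, so that symmetry steps can be treated like
  resolution steps. With a smaller \<open>L\<close>, fewer than one step and hence none would
  survive the greedy matching.\<close>

theorem php_bottleneck:
  fixes M :: "nat \<Rightarrow> (nat \<times> nat) set" and L :: nat
  assumes n: "4 \<le> n"
    and step: "\<And>t. t < L \<Longrightarrow>
      (\<exists>q. \<forall>i f. critical n i f \<and> avoids n i f (M t) \<longrightarrow> i = q) \<or>
      (\<exists>a<t. \<exists>b<t. \<forall>i f. critical n i f \<and> avoids n i f (M t) \<longrightarrow>
          avoids n i f (M a) \<or> avoids n i f (M b))"
    and root: "r < L" "M r = {}"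
  shows "(8/7) ^ ((n + 1) div 4) \<le> real L"
proof (rule ccontr)
  define k where "k = (n + 1) div 4"
  assume "\<not> ?thesis"
  then have "real L < (8/7) ^ k"
    by (simp add: k_def)
  have "k \<le> n"
    using n by (simp add: k_def)
  then obtain R where R: "R \<subseteq> {..n} \<times> {..<n}" "matching R" "card R = k"
    and bd: "real (card {t\<in>{..<L}. M t \<inter> R = {} \<and>
               (real n + 1)\<^sup>2 / 8 \<le> card (M t \<inter> remaining n R)}) \<le> (7/8) ^ k * L"
    using greedy_restriction[of "{..<L}" k n M] by auto
  have "(7/8) ^ k * real L < (7/8) ^ k * (8/7) ^ k"
    using \<open>real L < _\<close> by simp
  also have "\<dots> = 1"
    by (simp flip: power_mult_distrib)
  finally have "card {t\<in>{..<L}. M t \<inter> R = {} \<and>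
               (real n + 1)\<^sup>2 / 8 \<le> card (M t \<inter> remaining n R)} = 0"
    using bd by linarith
  then have none: "{t\<in>{..<L}. M t \<inter> R = {} \<and>
               (real n + 1)\<^sup>2 / 8 \<le> card (M t \<inter> remaining n R)} = {}"
    by (subst (asm) card_0_eq) auto
  have "3 < n + 1 - card R"
    using n R(3) by (simp add: k_def)
  then obtain t where t: "t < L" "M t \<inter> R = {}"
    and wide: "2 * (n + 1 - card R)\<^sup>2 \<le> 9 * card (M t \<inter> remaining n R)"
    using exists_wide_step[OF R(1,2) _ step root] by blast
  \<comment> \<open>Three quarters of the pigeons remain, and \<open>2/9 * (3/4)^2 = 1/8\<close> is
    the threshold used in \<open>greedy_restriction\<close>.\<close>
  have "3 * (n + 1) \<le> 4 * (n + 1 - card R)"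
    using R(3) by (simp add: k_def)
  then have "(3 * (n + 1))\<^sup>2 \<le> (4 * (n + 1 - card R))\<^sup>2"
    by (rule power_mono) simp
  then have "9 * (n + 1)\<^sup>2 \<le> 8 * (2 * (n + 1 - card R)\<^sup>2)"
    by (simp only: power_mult_distrib) simp
  also have "\<dots> \<le> 8 * (9 * card (M t \<inter> remaining n R))"
    using wide by simp
  finally have "(n + 1)\<^sup>2 \<le> 8 * card (M t \<inter> remaining n R)"
    by simp
  then have "real ((n + 1)\<^sup>2) \<le> real (8 * card (M t \<inter> remaining n R))"
    by (simp only: of_nat_le_iff)
  then have "(real n + 1)\<^sup>2 / 8 \<le> card (M t \<inter> remaining n R)"
    by (simp add: add.commute)
  then show False
    using none t by blast
qed

subsection \<open>Polarised pigeonhole formulas\<close>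

text \<open>The encoding is onto, so a permutation of one index is a permutation of all variables,
  as a symmetry has to be.\<close>

definition var :: "nat \<Rightarrow> nat \<Rightarrow> nat \<Rightarrow> nat \<Rightarrow> nat" where
  "var i k j t = prod_encode (prod_encode (i, k), prod_encode (j, t))"

lemma var_eq_iff [simp]:
  "var i k j t = var i' k' j' t' \<longleftrightarrow> i = i' \<and> k = k' \<and> j = j' \<and> t = t'"
  by (auto simp: var_def)

lemma var_cases: obtains i k j t where "v = var i k j t"
  unfolding var_def by (metis prod.collapse prod_decode_inverse)

text \<open>
  The diagonal variables say that pigeon \<open>i\<close> sits in hole \<open>j\<close>; the variables \<open>var i k j t\<close> with
  \<open>i < k\<close> are padding, forced to be false.
\<close>

abbreviation X :: "nat \<Rightarrow> nat \<Rightarrow> nat" where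
  "X i j \<equiv> var i i j 0"

text \<open>\<open>s\<close> marks the variables whose two literals are exchanged;
  \<open>plit\<close> and \<open>nlit\<close> are the positive and negative literals of the formula
  before the exchange.\<close>

definition plit :: "(nat \<Rightarrow> bool) \<Rightarrow> nat \<Rightarrow> nat lit" where
  "plit s v = (if s v then Neg v else Pos v)"

definition nlit :: "(nat \<Rightarrow> bool) \<Rightarrow> nat \<Rightarrow> nat lit" where
  "nlit s v = (if s v then Pos v else Neg v)"

lemma neg_neg [simp]: "neg (neg l) = l"
  by (cases l) auto

lemma neg_eq_iff [simp]: "neg l = neg l' \<longleftrightarrow> l = l'"
  by (metis neg_neg)

lemma neg_plit [simp]: "neg (plit s v) = nlit s v" and neg_nlit [simp]: "neg (nlit s v) = plit s v"
  by (auto simp: plit_def nlit_def)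

lemma plit_nlit_eq_iff [simp]:
  "plit s v = plit s w \<longleftrightarrow> v = w" "nlit s v = nlit s w \<longleftrightarrow> v = w" "plit s v \<noteq> nlit s w" "nlit s v \<noteq> plit s w"
  by (auto simp: plit_def nlit_def)

lemma lit_cases:
  obtains v where "l = plit s v" | v where "l = nlit s v"
  by (metis lit.exhaust nlit_def plit_def)

definition pigeon_clause :: "(nat \<Rightarrow> bool) \<Rightarrow> nat \<Rightarrow> nat \<Rightarrow> nat clause" where
  "pigeon_clause s n i = (\<lambda>j. plit s (X i j)) ` {..<n}"

definition hole_clause :: "(nat \<Rightarrow> bool) \<Rightarrow> nat \<Rightarrow> nat \<times> nat \<times> nat \<Rightarrow> nat clause" where
  "hole_clause s m = (\<lambda>(i, k, j). {nlit s (X i j), nlit s (X k j)} \<union> (\<lambda>t. plit s (var i k j t)) ` {..<m})"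

definition collisions :: "nat \<Rightarrow> (nat \<times> nat \<times> nat) set" where
  "collisions n = {(i, k, j). i < k \<and> k \<le> n \<and> j < n}"

definition pad_units :: "(nat \<Rightarrow> bool) \<Rightarrow> nat \<Rightarrow> nat \<Rightarrow> nat cnf" where
  "pad_units s m n = (\<lambda>((i, k, j), t). {nlit s (var i k j t)}) ` (collisions n \<times> {..<m})"

definition padded_php :: "(nat \<Rightarrow> bool) \<Rightarrow> nat \<Rightarrow> nat \<Rightarrow> nat cnf" where
  "padded_php s m n =
     pigeon_clause s n ` {..n} \<union> hole_clause s m ` collisions n \<union> pad_units s m n"

lemma padded_php_cases:
  assumes "C \<in> padded_php s m n"
  obtains (pigeon) i where "i \<le> n" "C = pigeon_clause s n i"
  | (hole) i k j where "i < k" "k \<le> n" "j < n" "C = hole_clause s m (i, k, j)"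
  | (unit) i k j t where "i < k" "k \<le> n" "j < n" "t < m" "C = {nlit s (var i k j t)}"
  using assms unfolding padded_php_def pad_units_def collisions_def by fastforce

lemma pad_unitsE:
  assumes "C \<in> pad_units s m n"
  obtains i k j t where "i < k" "k \<le> n" "j < n" "t < m" "C = {nlit s (var i k j t)}"
  using assms unfolding pad_units_def collisions_def by fastforce

lemma pad_unitsI:
  "i < k \<Longrightarrow> k \<le> n \<Longrightarrow> j < n \<Longrightarrow> t < m \<Longrightarrow> {nlit s (var i k j t)} \<in> pad_units s m n"
  unfolding pad_units_def collisions_def by force

lemma collisions_subset: "collisions n \<subseteq> {..n} \<times> {..n} \<times> {..<n}"
  by (auto simp: collisions_def)

lemma finite_collisions [simp]: "finite (collisions n)"
  using collisions_subset by (rule finite_subset) simp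

lemma card_collisions: "card (collisions n) \<le> (n + 1) ^ 3"
proof -
  have "card (collisions n) \<le> card ({..n} \<times> {..n} \<times> {..<n})"
    using collisions_subset by (rule card_mono[rotated]) simp
  also have "\<dots> \<le> (n + 1) ^ 3"
    by (simp add: power3_eq_cube algebra_simps)
  finally show ?thesis .
qed

lemma is_cnf_padded_php: "is_cnf (padded_php s m n)"
  by (auto simp: is_cnf_def padded_php_def pad_units_def pigeon_clause_def hole_clause_def)

text \<open>Here \<open>w\<close> assigns the variables as they were before the polarity was
  applied.\<close>

definition holds :: "(nat \<Rightarrow> bool) \<Rightarrow> (nat \<Rightarrow> bool) \<Rightarrow> nat lit \<Rightarrow> bool" where
  "holds s w l \<longleftrightarrow> lit_true (\<lambda>v. w v \<noteq> s v) l"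

lemma holds_simps [simp]:
  "holds s w (plit s v) \<longleftrightarrow> w v" "holds s w (nlit s v) \<longleftrightarrow> \<not> w v"
  "holds s w (neg l) \<longleftrightarrow> \<not> holds s w l"
  by (auto simp: holds_def plit_def nlit_def) (cases l; simp)+

lemma unsatisfiable_padded_php: "unsatisfiable (padded_php s m n)"
  unfolding unsatisfiable_def
proof
  assume "\<exists>v. satisfies v (padded_php s m n)"
  then obtain v where v: "satisfies v (padded_php s m n)" by blast
  define w where "w x = (v x \<noteq> s x)" for x
  have "(\<lambda>x. w x \<noteq> s x) = v"
    by (auto simp: w_def)
  then have holds: "lit_true v = holds s w"
    by (simp add: holds_def fun_eq_iff)
  have sat: "\<exists>l\<in>C. holds s w l" if "C \<in> padded_php s m n" for C
    using v that unfolding satisfies_def holds by blast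
  have "\<exists>j<n. w (X i j)" if "i \<le> n" for i
    using sat[of "pigeon_clause s n i"] that by (auto simp: padded_php_def pigeon_clause_def)
  then obtain g where g: "\<And>i. i \<le> n \<Longrightarrow> g i < n \<and> w (X i (g i))"
    by metis
  then have "g ` {..n} \<subseteq> {..<n}" by auto
  then have "card (g ` {..n}) \<le> n"
    using card_mono[of "{..<n}" "g ` {..n}"] by simp
  then have "\<not> inj_on g {..n}"
    by (auto dest: card_image)
  then obtain i k where ik: "i < k" "k \<le> n" "g i = g k"
    unfolding inj_on_def by (metis atMost_iff linorder_neqE_nat)
  define j where "j = g i"
  have "j < n" "w (X i j)" "w (X k j)"
    using g[of i] g[of k] ik by (auto simp: j_def)
  moreover have c: "(i, k, j) \<in> collisions n"
    using ik \<open>j < n\<close> by (simp add: collisions_def)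
  moreover have "\<not> w (var i k j t)" if "t < m" for t
    using sat[of "{nlit s (var i k j t)}"] c that
    unfolding padded_php_def pad_units_def by force
  ultimately show False
    using sat[of "hole_clause s m (i, k, j)"]
    by (auto simp: padded_php_def hole_clause_def)
qed

subsection \<open>Rigidity makes local symmetries useless\<close>

text \<open>
  The clauses in \<open>U\<close> are units setting their literals; on all other clauses a symmetry taking input
  clauses to input clauses acts trivially. As two such clauses clash in at most one variable, a
  symmetry also fixes every variable occurring in them with both signs; the remaining literals are
  never resolved away and are therefore permuted within a derived clause.
\<close>

locale rigid =
  fixes F U :: "'a cnf"
  assumes unit: "C \<in> U \<Longrightarrow> \<exists>l. C = {l}"
    and sym_trivial: "is_symmetry \<phi> \<Longrightarrow> is_positive \<phi> \<Longrightarrow> C \<in> F \<Longrightarrow> \<phi> ` C \<in> F \<Longrightarrow>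
      (C \<in> U \<and> \<phi> ` C \<in> U) \<or> (C \<notin> U \<and> \<phi> ` C = C)"
    and clash: "C \<in> F - U \<Longrightarrow> D \<in> F - U \<Longrightarrow> l \<in> C \<Longrightarrow> l' \<in> C \<Longrightarrow> neg l \<in> D \<Longrightarrow>
      neg l' \<in> D \<Longrightarrow> l = l'"
begin

text \<open>\<open>S\<close> is the set of inputs behind \<open>A\<close>. A literal whose negation
  does not occur in \<open>S\<close> can never be resolved upon, and a unit is used up when it is
  resolved.\<close>

definition keeps_pure :: "'a clause \<Rightarrow> 'a cnf \<Rightarrow> bool" where
  "keeps_pure A S \<longleftrightarrow>
     A \<subseteq> \<Union> (S - U) \<and> (\<forall>l \<in> \<Union> (S - U). neg l \<notin> \<Union> S \<longrightarrow> l \<in> A)"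

lemma map_clauses_diff:
  assumes "is_symmetry \<phi>" "is_positive \<phi>" "S \<subseteq> F" "map_clauses \<phi> S \<subseteq> F"
  shows "map_clauses \<phi> S - U = S - U" "\<And>C. C \<in> S - U \<Longrightarrow> \<phi> ` C = C"
proof -
  have eq: "(C \<in> U \<and> \<phi> ` C \<in> U) \<or> (C \<notin> U \<and> \<phi> ` C = C)" if "C \<in> S" for C
    using sym_trivial[OF assms(1,2), of C] assms(3,4) that by blast
  show triv: "\<phi> ` C = C" if "C \<in> S - U" for C
    using eq[of C] that by simp
  show "map_clauses \<phi> S - U = S - U"
  proof
    show "map_clauses \<phi> S - U \<subseteq> S - U"
    proof
      fix D assume "D \<in> map_clauses \<phi> S - U"
      then obtain C where C: "C \<in> S" "D = \<phi> ` C" "D \<notin> U"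
        by auto
      then show "D \<in> S - U"
        using eq[of C] by simp
    qed
    show "S - U \<subseteq> map_clauses \<phi> S - U"
    proof
      fix C assume C: "C \<in> S - U"
      then have "\<phi> ` C \<in> map_clauses \<phi> S - U"
        using triv[of C] by auto
      then show "C \<in> map_clauses \<phi> S - U"
        using triv[of C] C by simp
    qed
  qed
qed

text \<open>The literal resolved upon occurs in the inputs with both signs, so no pure literal is
  lost; a unit premise contributes nothing to the resolvent.\<close>

lemma resolve_keeps_pure:
  assumes SF: "S \<subseteq> F" and TF: "T \<subseteq> F"
    and A: "A \<in> U \<and> S = {A} \<or> keeps_pure A S"
    and B: "B \<in> U \<and> T = {B} \<or> keeps_pure B T"
    and l: "l \<in> A" "neg l \<in> B"
  shows "keeps_pure ((A - {l}) \<union> (B - {neg l})) (S \<union> T)"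
proof -
  have AS: "A \<subseteq> \<Union>S" and BT: "B \<subseteq> \<Union>T"
    using A B by (auto simp: keeps_pure_def)
  have A': "A - {l} \<subseteq> \<Union> (S - U) \<and> (\<forall>x \<in> \<Union> (S - U). neg x \<notin> \<Union> S \<longrightarrow> x \<in> A)"
    using A
  proof
    assume *: "A \<in> U \<and> S = {A}"
    then have "A = {l}"
      using unit l by (metis singletonD)
    then show ?thesis
      using * by auto
  qed (auto simp: keeps_pure_def)
  have B': "B - {neg l} \<subseteq> \<Union> (T - U) \<and> (\<forall>x \<in> \<Union> (T - U). neg x \<notin> \<Union> T \<longrightarrow> x \<in> B)"
    using B
  proof
    assume *: "B \<in> U \<and> T = {B}"
    then have "B = {neg l}"
      using unit l by (metis singletonD)
    then show ?thesis
      using * by auto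
  qed (auto simp: keeps_pure_def)
  show ?thesis
    unfolding keeps_pure_def
  proof (intro conjI ballI impI)
    show "A - {l} \<union> (B - {neg l}) \<subseteq> \<Union> (S \<union> T - U)"
      using A' B' by blast
    fix x assume x: "x \<in> \<Union> (S \<union> T - U)" "neg x \<notin> \<Union> (S \<union> T)"
    then have "x \<in> A \<or> x \<in> B"
      using A' B' by blast
    moreover have "x \<noteq> l" "x \<noteq> neg l"
      using x AS BT l by auto
    ultimately show "x \<in> A - {l} \<union> (B - {neg l})"
      by blast
  qed
qed

lemma symmetry_keeps_pure:
  assumes sym: "is_symmetry \<phi>" "is_positive \<phi>"
    and SF: "S \<subseteq> F" "map_clauses \<phi> S \<subseteq> F" and A: "keeps_pure A S"
  shows "keeps_pure (\<phi> ` A) (map_clauses \<phi> S)"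
proof -
  note diff = map_clauses_diff[OF sym SF]
  have ne: "\<phi> (neg l) = neg (\<phi> l)" for l
    using sym by (simp add: is_symmetry_def)
  have un: "\<phi> ` \<Union> (S - U) = \<Union> (S - U)"
  proof -
    have "\<phi> ` \<Union> (S - U) = (\<Union>C\<in>S - U. \<phi> ` C)"
      by blast
    also have "\<dots> = (\<Union>C\<in>S - U. C)"
      by (rule SUP_cong) (use diff in auto)
    finally show ?thesis by simp
  qed
  have un': "\<phi> ` \<Union> S = \<Union> (map_clauses \<phi> S)"
    by blast
  show ?thesis
    unfolding keeps_pure_def diff(1)
  proof (intro conjI ballI impI)
    show "\<phi> ` A \<subseteq> \<Union> (S - U)"
      using A un unfolding keeps_pure_def by blast
    fix l assume l: "l \<in> \<Union> (S - U)" "neg l \<notin> \<Union> (map_clauses \<phi> S)"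
    then obtain x where x: "x \<in> \<Union> (S - U)" "l = \<phi> x"
      using un by blast
    then have "neg x \<notin> \<Union> S"
      using l(2) ne un' by (metis imageI)
    then show "l \<in> \<phi> ` A"
      using A x unfolding keeps_pure_def by blast
  qed
qed

text \<open>A literal \<open>l\<close> of \<open>A\<close> lies in a fixed clause and is thus some
  \<open>\<phi> x\<close>. If \<open>x\<close> is pure, it is in \<open>A\<close> and
  \<open>l\<close> is in the image; if \<open>x\<close> clashes with a unit, \<open>l\<close> is
  false anyway; if it clashes with another clause, \<open>x = l\<close>.\<close>

lemma symmetry_falsified:
  assumes sym: "is_symmetry \<phi>" "is_positive \<phi>"
    and SF: "S \<subseteq> F" "map_clauses \<phi> S \<subseteq> F" and A: "A \<in> U \<and> S = {A} \<or> keeps_pure A S"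
    and units: "\<And>l. {l} \<in> U \<Longrightarrow> \<not> false l \<and> false (neg l)"
    and fal: "\<forall>l\<in>\<phi> ` A. false l"
  shows "\<forall>l\<in>A. false l"
  using A
proof
  assume AU: "A \<in> U \<and> S = {A}"
  then have "\<phi> ` A \<in> U"
    using sym_trivial[OF sym, of A] SF by simp
  then obtain l where "\<phi> ` A = {l}" "{l} \<in> U"
    using unit by metis
  then show ?thesis
    using units[of l] fal by auto
next
  assume A: "keeps_pure A S"
  note diff = map_clauses_diff[OF sym SF]
  have ne: "\<phi> (neg l) = neg (\<phi> l)" for l
    using sym by (simp add: is_symmetry_def)
  show ?thesis
  proof
    fix l assume l: "l \<in> A"
    then obtain C where C: "C \<in> S - U" "l \<in> C"
      using A unfolding keeps_pure_def by blast
    then have "l \<in> \<phi> ` C"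
      using diff(2)[OF C(1)] by simp
    then obtain x where x: "x \<in> C" "\<phi> x = l"
      by auto
    show "false l"
    proof (cases "neg x \<in> \<Union> S")
      case False
      then have "x \<in> A"
        using A x(1) C(1) by (auto simp: keeps_pure_def)
      then have "l \<in> \<phi> ` A"
        using rev_image_eqI[of x A l \<phi>] x(2) by simp
      then show ?thesis
        by (rule bspec[OF fal])
    next
      case True
      then obtain D where D: "D \<in> S" "neg x \<in> D" by blast
      show ?thesis
      proof (cases "D \<in> U")
        case True
        moreover have "D \<in> F" "\<phi> ` D \<in> F"
          using SF D(1) by auto
        ultimately have "\<phi> ` D \<in> U"
          using sym_trivial[OF sym, of D] by simp
        moreover have "neg l \<in> \<phi> ` D"
          using imageI[OF D(2), of \<phi>] x(2) ne[of x] by simp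
        ultimately have "{neg l} \<in> U"
          using unit by (metis singletonD)
        then show ?thesis
          using units[of "neg l"] by simp
      next
        case False
        \<comment> \<open>\<open>C\<close> and \<open>D\<close> are both fixed, so they clash in
          \<open>l\<close> as well as in \<open>x\<close>.\<close>
        then have "neg l \<in> D"
          using diff(2)[of D] imageI[OF D(2), of \<phi>] D(1) x(2) ne[of x] by simp
        then have "l = x"
          using clash[of C D l x] C x(1) D False SF by auto
        then have "\<phi> l = l"
          using x(2) by simp
        then show ?thesis
          using bspec[OF fal imageI[OF l]] by simp
      qed
    qed
  qed
qed

lemma SR_II_premises:
  assumes "SR_II F B \<phi>" "S \<subseteq> B"
  shows "is_symmetry \<phi>" "is_positive \<phi>" "S \<subseteq> F" "map_clauses \<phi> S \<subseteq> F"
  using assms image_mono[OF assms(2), of "\<lambda>C. \<phi> ` C"] unfolding SR_II_def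
  by (meson subset_trans)+

lemma inferred_SR_II_keeps_pure:
  assumes "inferred SR_II F cs i S"
  shows "S \<subseteq> F \<and> (cs ! i \<in> U \<and> S = {cs ! i} \<or> keeps_pure (cs ! i) S)"
  using assms
proof induction
  case (input i)
  then show ?case
    by (cases "cs ! i \<in> U") (auto simp: keeps_pure_def)
next
  case (resolution i j k S T x)
  then have "keeps_pure (cs ! i) (S \<union> T)"
    using resolve_keeps_pure[of S T "cs ! j" "cs ! k" "Pos x"] by simp
  then show ?case
    using resolution.IH by simp
next
  case (symmetry i j S B \<phi>)
  note prem = SR_II_premises[OF symmetry.hyps(5,4)]
  show ?case
    using symmetry.IH
  proof (elim conjE disjE)
    assume j: "cs ! j \<in> U" "S = {cs ! j}"
    then have "\<phi> ` (cs ! j) \<in> U"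
      using sym_trivial[OF prem(1,2), of "cs ! j"] prem(3,4) by simp
    then show ?thesis
      using prem(4) symmetry.hyps(6) j(2) by simp
  next
    assume "keeps_pure (cs ! j) S"
    then show ?thesis
      using symmetry_keeps_pure[OF prem] prem(4) symmetry.hyps(6) by simp
  qed
qed

text \<open>On assignments satisfying the units a symmetry step is a trivial inference: both
  \<open>a\<close> and \<open>b\<close> are its premise.\<close>

lemma inferred_SR_II_falsified:
  assumes "inferred SR_II F cs i S"
  shows "cs ! i \<in> F \<or> (\<exists>a<i. \<exists>b<i. \<forall>w. (\<forall>l. {l} \<in> U \<longrightarrow> lit_true w l) \<longrightarrow>
           (\<forall>l\<in>cs ! i. \<not> lit_true w l) \<longrightarrow>
           (\<forall>l\<in>cs ! a. \<not> lit_true w l) \<or> (\<forall>l\<in>cs ! b. \<not> lit_true w l))"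
  using assms
proof cases
  case (resolution j k S T x)
  have "(\<forall>l\<in>cs ! j. \<not> lit_true w l) \<or> (\<forall>l\<in>cs ! k. \<not> lit_true w l)"
    if "\<forall>l\<in>cs ! i. \<not> lit_true w l" for w
  proof (cases "w x")
    case True
    then have "\<forall>l\<in>cs ! k. \<not> lit_true w l"
      using that resolution(9) by auto
    then show ?thesis ..
  next
    case False
    then have "\<forall>l\<in>cs ! j. \<not> lit_true w l"
      using that resolution(9) by auto
    then show ?thesis ..
  qed
  then show ?thesis
    using resolution(3,4) by meson
next
  case (symmetry j S B \<phi>)
  note inv = inferred_SR_II_keeps_pure[OF symmetry(4)]
  note prem = SR_II_premises[OF symmetry(6,5)]
  have "\<forall>l\<in>cs ! j. \<not> lit_true w l"
    if w: "\<forall>l. {l} \<in> U \<longrightarrow> lit_true w l" "\<forall>l\<in>cs ! i. \<not> lit_true w l" for w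
  proof (rule symmetry_falsified[OF prem])
    show "\<not> \<not> lit_true w l \<and> \<not> lit_true w (neg l)" if "{l} \<in> U" for l
      using that w(1) by (cases l) auto
    show "\<forall>l\<in>\<phi> ` (cs ! j). \<not> lit_true w l"
      using w(2) symmetry(7) by simp
  qed (use inv in simp)
  then show ?thesis
    using symmetry(3) by meson
qed simp

end

subsection \<open>The polarity\<close>

text \<open>The numeral with digits \<open>i\<close>, \<open>k\<close>, \<open>j\<close> in base
  \<open>n + 1\<close>.\<close>

definition code :: "nat \<Rightarrow> nat \<Rightarrow> nat \<Rightarrow> nat \<Rightarrow> nat" where
  "code n i k j = (i * (n + 1) + k) * (n + 1) + j"

lemma mixed_radix_less:
  assumes "(a::nat) < b" "c < d"
  shows "a * d + c < b * d"
proof -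
  have "a * d + c < Suc a * d"
    using assms(2) by simp
  also have "\<dots> \<le> b * d"
    using assms(1) by (intro mult_right_mono) auto
  finally show ?thesis .
qed

lemma code_less:
  assumes "i \<le> n" "k \<le> n" "j \<le> n"
  shows "code n i k j < (n + 1) ^ 3"
proof -
  have "i * (n + 1) + k < (n + 1) * (n + 1)"
    using assms by (intro mixed_radix_less) auto
  then have "code n i k j < (n + 1) * (n + 1) * (n + 1)"
    unfolding code_def using assms by (intro mixed_radix_less) auto
  then show ?thesis
    by (simp add: power3_eq_cube)
qed

lemma mixed_radix_inj:
  assumes "(a::nat) * d + c = a' * d + c'" "c < d" "c' < d"
  shows "a = a' \<and> c = c'"
proof -
  have "(a * d + c) div d = a" "(a' * d + c') div d = a'"
    using assms(2,3) by auto
  then have "a = a'"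
    using assms(1) by metis
  then show ?thesis
    using assms(1) by simp
qed

lemma code_inj:
  assumes "code n i k j = code n i' k' j'" "k \<le> n" "j \<le> n" "k' \<le> n" "j' \<le> n"
  shows "i = i'" "k = k'" "j = j'"
proof -
  have 1: "i * (n + 1) + k = i' * (n + 1) + k' \<and> j = j'"
    by (rule mixed_radix_inj[OF assms(1)[unfolded code_def]]) (use assms in auto)
  have "i = i' \<and> k = k'"
    by (rule mixed_radix_inj[OF conjunct1[OF 1]]) (use assms in auto)
  then show "i = i'" "k = k'" "j = j'"
    using 1 by auto
qed

text \<open>
  The polarity makes the number of negative literals a complete invariant: it is \<open>i\<close> in the clause
  of pigeon \<open>i\<close>, and \<open>3 * code n i k j\<close> up to an error of at most 2 in a hole clause.
\<close>

definition polarity :: "nat \<Rightarrow> nat \<Rightarrow> bool" where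
  "polarity n v = (case prod_decode v of (a, b) \<Rightarrow> case prod_decode a of (i, k) \<Rightarrow>
     case prod_decode b of (j, t) \<Rightarrow> if i = k then j < i else t < 3 * code n i k j)"

lemma polarity_var [simp]:
  "polarity n (var i k j t) = (if i = k then j < i else t < 3 * code n i k j)"
  by (simp add: polarity_def var_def)

text \<open>The padding has room for \<open>3 * code n i k j\<close> negative literals in every hole
  clause, and makes hole clauses longer than pigeon clauses.\<close>

definition hard_php :: "nat \<Rightarrow> nat cnf" where
  "hard_php n = padded_php (polarity n) (3 * (n + 1) ^ 3) n"

definition num_neg :: "'a clause \<Rightarrow> nat" where
  "num_neg C = card {v. Neg v \<in> C}"

text \<open>This is where positivity enters: negative literals are mapped to negative ones by an
  injective variable map.\<close>

lemma num_neg_positive_symmetry: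
  assumes "is_symmetry \<phi>" "is_positive \<phi>"
  shows "num_neg (\<phi> ` C) = num_neg C"
proof -
  obtain h where h: "\<And>x. \<phi> (Pos x) = Pos (h x)"
    using assms(2) unfolding is_positive_def by metis
  have inj: "inj \<phi>" and "\<And>l. \<phi> (neg l) = neg (\<phi> l)"
    using assms(1) by (auto simp: is_symmetry_def bij_def)
  then have h': "\<phi> (Neg x) = Neg (h x)" for x
    using h by (metis neg.simps(1))
  have "inj h"
    using inj h by (metis injD injI lit.inject(1))
  have "{v. Neg v \<in> \<phi> ` C} = h ` {v. Neg v \<in> C}"
  proof (intro set_eqI iffI)
    fix v assume "v \<in> {v. Neg v \<in> \<phi> ` C}"
    then obtain l where l: "l \<in> C" "Neg v = \<phi> l"
      by auto
    then show "v \<in> h ` {v. Neg v \<in> C}"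
      using h h' by (cases l) auto
  next
    fix v assume "v \<in> h ` {v. Neg v \<in> C}"
    then show "v \<in> {v. Neg v \<in> \<phi> ` C}"
      using h' by (auto simp flip: h')
  qed
  then show ?thesis
    using \<open>inj h\<close> unfolding num_neg_def by (metis card_image inj_on_subset subset_UNIV)
qed

lemma num_neg_pigeon_clause:
  assumes "i \<le> n"
  shows "num_neg (pigeon_clause (polarity n) n i) = i"
proof -
  have "{v. Neg v \<in> pigeon_clause (polarity n) n i} = X i ` {..<i}"
    using assms by (auto simp: pigeon_clause_def plit_def image_iff)
  then show ?thesis
    by (simp add: num_neg_def card_image inj_on_def)
qed

lemma num_neg_hole_clause:
  assumes "i < k" "k \<le> n" "j < n"
  defines "C \<equiv> hole_clause (polarity n) (3 * (n + 1) ^ 3) (i, k, j)"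
  shows "3 * code n i k j \<le> num_neg C" "num_neg C \<le> 3 * code n i k j + 2"
proof -
  define Y where "Y = (\<lambda>t. var i k j t) ` {..<3 * code n i k j}"
  have cY: "card Y = 3 * code n i k j" and fY: "finite Y"
    by (auto simp: Y_def card_image inj_on_def)
  have "code n i k j < (n + 1) ^ 3"
    using assms by (intro code_less) auto
  then have "Y \<subseteq> {v. Neg v \<in> C}"
    using assms(1) by (auto simp: C_def Y_def hole_clause_def plit_def image_iff)
  moreover have sub: "{v. Neg v \<in> C} \<subseteq> {X i j, X k j} \<union> Y"
    using assms(1) by (auto simp: C_def Y_def hole_clause_def plit_def nlit_def split: if_splits)
  then have "finite {v. Neg v \<in> C}"
    using fY finite_subset by blast
  ultimately show "3 * code n i k j \<le> num_neg C"
    unfolding num_neg_def cY[symmetric] by (intro card_mono)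
  have "num_neg C \<le> card ({X i j, X k j} \<union> Y)"
    unfolding num_neg_def using sub fY by (intro card_mono) auto
  also have "\<dots> \<le> card {X i j, X k j} + card Y"
    by (rule card_Un_le)
  also have "\<dots> \<le> 2 + card Y"
    by (simp add: card_insert_if)
  finally show "num_neg C \<le> 3 * code n i k j + 2"
    by (simp add: cY)
qed

lemma card_pigeon_clause: "card (pigeon_clause s n i) = n"
  by (simp add: pigeon_clause_def card_image inj_on_def)

lemma card_hole_clause: "m \<le> card (hole_clause s m (i, k, j))"
proof -
  have "m = card ((\<lambda>t. plit s (var i k j t)) ` {..<m})"
    by (simp add: card_image inj_on_def)
  also have "\<dots> \<le> card (hole_clause s m (i, k, j))"
    by (intro card_mono) (auto simp: hole_clause_def)
  finally show ?thesis .
qed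

text \<open>The size of a clause, which is 1, \<open>n\<close> or larger, reveals its kind, and
  \<open>num_neg\<close> then identifies a pigeon or hole clause. Clashes occur only between a
  pigeon and a hole clause, whose two pigeons differ.\<close>

lemma rigid_hard_php:
  assumes n: "2 \<le> n"
  shows "rigid (hard_php n) (pad_units (polarity n) (3 * (n + 1) ^ 3) n)"
proof
  let ?s = "polarity n" and ?m = "3 * (n + 1) ^ 3"
  let ?U = "pad_units ?s ?m n"
  have "n + 1 \<le> (n + 1) ^ 3"
    by (rule self_le_power) auto
  then have m: "n < ?m" by simp
  have size: "card C = 1 \<and> C \<in> ?U \<or> card C = n \<and> (\<exists>i\<le>n. C = pigeon_clause ?s n i) \<or>
      n < card C \<and> (\<exists>i k j. i < k \<and> k \<le> n \<and> j < n \<and> C = hole_clause ?s ?m (i, k, j))"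
    if "C \<in> hard_php n" for C
    using that unfolding hard_php_def
  proof (cases rule: padded_php_cases)
    case (hole i k j)
    then show ?thesis
      using card_hole_clause[of ?m ?s i k j] m by force
  qed (auto simp: card_pigeon_clause intro: pad_unitsI)
  have size1: "C \<in> ?U" if "C \<in> hard_php n" "card C = 1" for C
    using size[OF that(1)] that(2) n by (elim disjE conjE) simp_all
  have sizen: "\<exists>i\<le>n. C = pigeon_clause ?s n i" if "C \<in> hard_php n" "card C = n" for C
    using size[OF that(1)] that(2) n by (elim disjE conjE) simp_all
  have size_gt: "\<exists>i k j. i < k \<and> k \<le> n \<and> j < n \<and> C = hole_clause ?s ?m (i, k, j)"
    if "C \<in> hard_php n" "n < card C" for C
    using size[OF that(1)] that(2) n by (elim disjE conjE) simp_all
  have non_unit: "C \<notin> ?U" if "card C \<noteq> 1" for C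
    using that by (auto elim!: pad_unitsE)
  show "\<exists>l. C = {l}" if "C \<in> ?U" for C
    using that by (auto elim!: pad_unitsE)
  show "(C \<in> ?U \<and> \<phi> ` C \<in> ?U) \<or> (C \<notin> ?U \<and> \<phi> ` C = C)"
    if sym: "is_symmetry \<phi>" "is_positive \<phi>" and CF: "C \<in> hard_php n" "\<phi> ` C \<in> hard_php n" for \<phi> C
  proof -
    have "inj \<phi>"
      using sym(1) by (simp add: is_symmetry_def bij_def)
    then have card: "card (\<phi> ` C) = card C"
      by (metis card_image inj_on_subset subset_UNIV)
    have nn: "num_neg (\<phi> ` C) = num_neg C"
      using num_neg_positive_symmetry[OF sym] .
    consider "card C = 1" | "card C = n" | "n < card C"
      using size[OF CF(1)] by blast
    then show ?thesis
    proof cases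
      case 1
      then show ?thesis
        using size1[OF CF(1)] size1[OF CF(2)] card by simp
    next
      case 2
      obtain i where i: "i \<le> n" "C = pigeon_clause ?s n i"
        using sizen[OF CF(1) 2] by blast
      obtain i' where i': "i' \<le> n" "\<phi> ` C = pigeon_clause ?s n i'"
        using sizen[OF CF(2)] card 2 by metis
      have "i' = i"
        using nn num_neg_pigeon_clause[OF i(1)] num_neg_pigeon_clause[OF i'(1)]
        by (simp flip: i(2) i'(2))
      then show ?thesis
        using i(2) i'(2) non_unit[of C] 2 n by simp
    next
      case 3
      obtain i k j where C: "i < k" "k \<le> n" "j < n" "C = hole_clause ?s ?m (i, k, j)"
        using size_gt[OF CF(1) 3] by blast
      obtain i' k' j' where C': "i' < k'" "k' \<le> n" "j' < n"
        "\<phi> ` C = hole_clause ?s ?m (i', k', j')"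
        using size_gt[OF CF(2)] card 3 by metis
      \<comment> \<open>The factor 3 keeps the ranges of \<open>num_neg\<close> for different codes
        disjoint.\<close>
      have "code n i k j = code n i' k' j'"
        using num_neg_hole_clause[OF C(1-3)] num_neg_hole_clause[OF C'(1-3)] nn
        unfolding C(4)[symmetric] C'(4)[symmetric] by linarith
      then have "i = i' \<and> k = k' \<and> j = j'"
        using code_inj[of n i k j i' k' j'] C(1-3) C'(1-3) by simp
      then have "\<phi> ` C = C"
        using C(4) C'(4) by metis
      then show ?thesis
        using non_unit[of C] 3 n by simp
    qed
  qed
  show "l = l'"
    if C: "C \<in> hard_php n - ?U" and D: "D \<in> hard_php n - ?U"
      and l: "l \<in> C" "l' \<in> C" "neg l \<in> D" "neg l' \<in> D" for C D l l'
  proof -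
    have shape: "(\<exists>i. C = pigeon_clause ?s n i) \<or>
        (\<exists>i k j. i < k \<and> C = hole_clause ?s ?m (i, k, j))" if "C \<in> hard_php n - ?U" for C
      using size[of C] that by blast
    show ?thesis
      using shape[OF C] shape[OF D] l
      by (elim disjE exE conjE) (auto simp: pigeon_clause_def hole_clause_def)
  qed
qed

subsection \<open>The lower bound\<close>

definition graph_val :: "nat \<Rightarrow> nat \<Rightarrow> (nat \<Rightarrow> nat) \<Rightarrow> nat \<Rightarrow> bool" where
  "graph_val n i f v \<longleftrightarrow> (\<exists>k\<in>{..n} - {i}. v = X k (f k))"

lemma graph_val_var [simp]:
  "graph_val n i f (var k k' j t) \<longleftrightarrow> k = k' \<and> t = 0 \<and> k \<le> n \<and> k \<noteq> i \<and> f k = j"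
  by (auto simp: graph_val_def)

definition satisfied :: "nat \<Rightarrow> nat clause \<Rightarrow> nat \<Rightarrow> (nat \<Rightarrow> nat) \<Rightarrow> bool" where
  "satisfied n A i f \<longleftrightarrow> (\<exists>l\<in>A. holds (polarity n) (graph_val n i f) l)"

text \<open>A semantic form of the monotone translation of clauses, which replaces a negative
  literal by the other pigeons of its hole. It treats padding literals uniformly.\<close>

definition sufficient :: "nat \<Rightarrow> nat clause \<Rightarrow> (nat \<times> nat) set" where
  "sufficient n A = {(k, j). k \<le> n \<and> j < n \<and>
     (\<forall>i f. critical n i f \<longrightarrow> k \<noteq> i \<longrightarrow> f k = j \<longrightarrow> satisfied n A i f)}"

lemma criticalD:
  assumes "critical n i f"
  shows "i \<le> n" "\<And>k. k \<le> n \<Longrightarrow> k \<noteq> i \<Longrightarrow> f k < n"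
    "\<And>k k'. k \<le> n \<Longrightarrow> k \<noteq> i \<Longrightarrow> k' \<le> n \<Longrightarrow> k' \<noteq> i \<Longrightarrow> f k = f k' \<Longrightarrow> k = k'"
    "\<And>j. j < n \<Longrightarrow> \<exists>k\<le>n. k \<noteq> i \<and> f k = j"
proof -
  note b = assms[unfolded critical_def bij_betw_def]
  show "i \<le> n" using b by simp
  show "f k < n" if "k \<le> n" "k \<noteq> i" for k
    using b that by auto
  show "k = k'" if "k \<le> n" "k \<noteq> i" "k' \<le> n" "k' \<noteq> i" "f k = f k'" for k k'
    using b that by (auto dest: inj_onD)
  show "\<exists>k\<le>n. k \<noteq> i \<and> f k = j" if "j < n" for j
  proof -
    have "j \<in> f ` ({..n} - {i})"
      using b that by auto
    then show ?thesis by auto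
  qed
qed

text \<open>
  On critical assignments a negative literal on pigeon \<open>i\<close> and hole \<open>j\<close> says that some other pigeon
  sits in hole \<open>j\<close>, so clauses behave monotonically.
\<close>

lemma avoids_sufficient_iff:
  assumes crit: "critical n i f" and n: "1 \<le> n"
  shows "avoids n i f (sufficient n A) \<longleftrightarrow> \<not> satisfied n A i f"
proof
  assume "\<not> satisfied n A i f"
  then show "avoids n i f (sufficient n A)"
    using crit unfolding avoids_def sufficient_def by auto
next
  assume av: "avoids n i f (sufficient n A)"
  show "\<not> satisfied n A i f"
  proof
    assume "satisfied n A i f"
    then obtain l where l: "l \<in> A" "holds (polarity n) (graph_val n i f) l"
      unfolding satisfied_def by blast
    have "\<exists>k\<le>n. k \<noteq> i \<and> (\<forall>i' f'. critical n i' f' \<longrightarrow> k \<noteq> i' \<longrightarrow> f' k = f k \<longrightarrow>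
        holds (polarity n) (graph_val n i' f') l)"
    proof (cases l rule: lit_cases[where s = "polarity n"])
      case (1 v)
      then obtain k where "k \<le> n" "k \<noteq> i" "v = X k (f k)"
        using l(2) unfolding graph_val_def by auto
      then show ?thesis
        using 1 by (intro exI[of _ k]) auto
    next
      case (2 v)
      obtain a b j t where v: "v = var a b j t"
        by (rule var_cases)
      show ?thesis
      proof (cases "a = b \<and> t = 0 \<and> j < n")
        case True
        then obtain k where k: "k \<le> n" "k \<noteq> i" "f k = j"
          using criticalD(4)[OF crit] by blast
        have "\<not> graph_val n i' f' v" if "critical n i' f'" "k \<noteq> i'" "f' k = f k" for i' f'
        proof
          assume "graph_val n i' f' v"
          then have "a = k"
            using criticalD(3)[OF that(1), of a k] that k v by auto
          then show False
            using l(2) 2 v k True by auto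
        qed
        then show ?thesis
          using k 2 by auto
      next
        \<comment> \<open>The variable is false under every critical assignment, so any pigeon other
          than \<open>i\<close> is a witness.\<close>
        case False
        then have "\<not> graph_val n i' f' v" if "critical n i' f'" for i' f'
          using criticalD(2)[OF that] v by auto
        moreover have "\<exists>k\<le>n. k \<noteq> i"
          using n by (intro exI[of _ "if i = 0 then 1 else 0"]) auto
        ultimately show ?thesis
          using 2 by auto
      qed
    qed
    then obtain k where k: "k \<le> n" "k \<noteq> i"
      and all: "\<And>i' f'. critical n i' f' \<Longrightarrow> k \<noteq> i' \<Longrightarrow> f' k = f k \<Longrightarrow> satisfied n A i' f'"
      using l(1) unfolding satisfied_def by blast
    have "(k, f k) \<in> sufficient n A"
      using k all criticalD(2)[OF crit k] unfolding sufficient_def by simp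
    then show False
      using av k unfolding avoids_def by simp
  qed
qed

text \<open>A pair in no critical assignment would be sufficient vacuously, so each pair has to be
  extended to one.\<close>

lemma sufficient_empty:
  assumes "1 \<le> n"
  shows "sufficient n {} = {}"
proof (rule equals0I)
  fix e assume e: "e \<in> sufficient n {}"
  obtain k j where kj: "e = (k, j)"
    by (cases e)
  then have "k \<le> n" "j < n"
    using e by (simp_all add: sufficient_def)
  define i :: nat where "i = (if k = 0 then 1 else 0)"
  have "k \<noteq> i" "i \<le> n"
    using assms by (simp_all add: i_def)
  then have "\<exists>f. critical n i f \<and> extends {(k, j)} i f"
    using \<open>k \<le> n\<close> \<open>j < n\<close> by (intro critical_extension_exists) (simp_all add: matching_def)
  then obtain f where "critical n i f" "f k = j"
    by (auto simp: extends_def)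
  then have "satisfied n {} i f"
    using e kj \<open>k \<noteq> i\<close> by (simp add: sufficient_def)
  then show False
    by (simp add: satisfied_def)
qed

text \<open>Only pigeon clauses can be falsified by critical assignments; for the others
  \<open>q\<close> is arbitrary.\<close>

lemma falsified_input:
  assumes "C \<in> hard_php n"
  shows "\<exists>q. \<forall>i f. critical n i f \<and> \<not> satisfied n C i f \<longrightarrow> i = q"
  using assms unfolding hard_php_def
proof (cases rule: padded_php_cases)
  case (pigeon q)
  have "satisfied n C i f" if "critical n i f" "i \<noteq> q" for i f
  proof -
    have "f q < n"
      using criticalD(2)[OF that(1), of q] pigeon(1) that(2) by simp
    then have "plit (polarity n) (X q (f q)) \<in> C"
      by (simp add: pigeon(2) pigeon_clause_def)
    moreover have "holds (polarity n) (graph_val n i f) (plit (polarity n) (X q (f q)))"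
      using pigeon(1) that(2) by simp
    ultimately show ?thesis
      unfolding satisfied_def by (rule bexI[rotated])
  qed
  then show ?thesis by blast
next
  case (hole a b j)
  have "satisfied n C i f" if "critical n i f" for i f
  proof (rule ccontr)
    assume "\<not> satisfied n C i f"
    then have "graph_val n i f (X a j)" "graph_val n i f (X b j)"
      by (simp_all add: satisfied_def hole(4) hole_clause_def)
    then show False
      using criticalD(3)[OF that, of a b] hole(1) by simp
  qed
  then show ?thesis by blast
next
  case (unit a b j t)
  then show ?thesis
    by (auto simp: satisfied_def)
qed

theorem SR_II_lower_bound:
  assumes n: "4 \<le> n" and refutation: "is_proof SR_II (hard_php n) cs"
  shows "(8/7) ^ ((n + 1) div 4) \<le> real (length cs)"
proof (rule php_bottleneck[where M = "\<lambda>t. sufficient n (cs ! t)" and r = "length cs - 1"])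
  let ?U = "pad_units (polarity n) (3 * (n + 1) ^ 3) n"
  interpret rigid "hard_php n" ?U
    using n by (intro rigid_hard_php) simp
  show "4 \<le> n" by (rule n)
  have cs: "cs \<noteq> []" "last cs = {}"
    using refutation by (auto simp: is_proof_def)
  then show "length cs - 1 < length cs"
    by simp
  have "cs ! (length cs - 1) = {}"
    using cs by (simp add: last_conv_nth)
  then show "sufficient n (cs ! (length cs - 1)) = {}"
    using sufficient_empty n by simp
  fix t assume "t < length cs"
  then obtain S where S: "inferred SR_II (hard_php n) cs t S"
    using refutation by (auto simp: is_proof_def)
  have av: "critical n i f \<Longrightarrow> avoids n i f (sufficient n A) \<longleftrightarrow> \<not> satisfied n A i f"
    for i f A
    using avoids_sufficient_iff[of n i f A] n by auto
  show "(\<exists>q. \<forall>i f. critical n i f \<and> avoids n i f (sufficient n (cs ! t)) \<longrightarrow> i = q) \<or>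
      (\<exists>a<t. \<exists>b<t. \<forall>i f. critical n i f \<and> avoids n i f (sufficient n (cs ! t)) \<longrightarrow>
          avoids n i f (sufficient n (cs ! a)) \<or> avoids n i f (sufficient n (cs ! b)))"
    using inferred_SR_II_falsified[OF S]
  proof (elim disjE exE conjE)
    assume "cs ! t \<in> hard_php n"
    then obtain q where q: "\<And>i f. critical n i f \<Longrightarrow> \<not> satisfied n (cs ! t) i f \<Longrightarrow> i = q"
      using falsified_input by blast
    show ?thesis
      by (intro disjI1 exI[of _ q] allI impI, elim conjE, rule q) (simp_all add: av)
  next
    fix a b assume ab: "a < t" "b < t"
      and *: "\<forall>w. (\<forall>l. {l} \<in> ?U \<longrightarrow> lit_true w l) \<longrightarrow> (\<forall>l\<in>cs ! t. \<not> lit_true w l) \<longrightarrow>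
           (\<forall>l\<in>cs ! a. \<not> lit_true w l) \<or> (\<forall>l\<in>cs ! b. \<not> lit_true w l)"
    have "\<not> satisfied n (cs ! a) i f \<or> \<not> satisfied n (cs ! b) i f"
      if "\<not> satisfied n (cs ! t) i f" for i f
    proof -
      have "\<forall>l. {l} \<in> ?U \<longrightarrow> holds (polarity n) (graph_val n i f) l"
        by (auto elim!: pad_unitsE)
      \<comment> \<open>Shifting by the polarity turns \<open>holds\<close> into
        \<open>lit_true\<close>.\<close>
      then show ?thesis
        using *[rule_format, of "\<lambda>v. graph_val n i f v \<noteq> polarity n v"] that
        unfolding satisfied_def holds_def by blast
    qed
    then show ?thesis
      using ab av by (intro disjI2 exI[of _ a] exI[of _ b] conjI) auto
  qed
qed

subsection \<open>The upper bound\<close>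

text \<open>Forgetting the order of the sequence lets derivations be composed without indices, while
  \<open>N\<close> still bounds their length.\<close>

definition derives :: "'a sym_cond \<Rightarrow> 'a cnf \<Rightarrow> nat \<Rightarrow> 'a cnf \<Rightarrow> bool" where
  "derives R F N K \<longleftrightarrow>
     (\<exists>cs. (\<forall>i < length cs. \<exists>S. inferred R F cs i S) \<and> length cs \<le> N \<and> K \<subseteq> set cs)"

lemma inferred_append:
  assumes "inferred R F cs i S"
  shows "inferred R F (cs @ ds) i S"
  using assms
proof induction
  case (input i)
  then show ?case
    using inferred.input[of i "cs @ ds" F R] by (simp add: nth_append)
next
  case (resolution i j k S T x)
  then show ?case
    by (intro inferred.resolution[of i _ j k _ _ S T x]) (simp_all add: nth_append)
next
  case (symmetry i j S B \<phi>)
  then show ?case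
    by (intro inferred.symmetry[of i _ j _ _ S B \<phi>]) (simp_all add: nth_append)
qed

lemma derives_mono: "derives R F N K \<Longrightarrow> N \<le> N' \<Longrightarrow> K' \<subseteq> K \<Longrightarrow> derives R F N' K'"
  unfolding derives_def by (meson order_trans)

lemma inferred_snoc:
  assumes "\<forall>i < length cs. \<exists>S. inferred R F cs i S" "\<exists>S. inferred R F (cs @ [C]) (length cs) S"
  shows "\<forall>i < length (cs @ [C]). \<exists>S. inferred R F (cs @ [C]) i S"
proof (intro allI impI)
  fix i assume i: "i < length (cs @ [C])"
  show "\<exists>S. inferred R F (cs @ [C]) i S"
  proof (cases "i < length cs")
    case True
    then obtain S where "inferred R F cs i S"
      using assms(1) by blast
    then show ?thesis
      using inferred_append by blast
  next
    case False
    then have "i = length cs"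
      using i by simp
    then show ?thesis
      using assms(2) by simp
  qed
qed

lemma derives_extend:
  assumes "derives R F N K"
    and new: "\<And>cs. \<forall>i < length cs. \<exists>S. inferred R F cs i S \<Longrightarrow> K \<subseteq> set cs \<Longrightarrow>
      \<exists>S. inferred R F (cs @ [C]) (length cs) S"
  shows "derives R F (Suc N) (insert C K)"
proof -
  obtain cs where cs: "\<forall>i < length cs. \<exists>S. inferred R F cs i S" "length cs \<le> N" "K \<subseteq> set cs"
    using assms(1) unfolding derives_def by blast
  have "\<forall>i < length (cs @ [C]). \<exists>S. inferred R F (cs @ [C]) i S"
    using inferred_snoc[OF cs(1) new[OF cs(1,3)]] .
  moreover have "length (cs @ [C]) \<le> Suc N" "insert C K \<subseteq> set (cs @ [C])"
    using cs by auto
  ultimately show ?thesis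
    unfolding derives_def by blast
qed

lemma derives_input:
  assumes "derives R F N K" "C \<in> F"
  shows "derives R F (Suc N) (insert C K)"
proof (rule derives_extend[OF assms(1)])
  show "\<exists>S. inferred R F (cs @ [C]) (length cs) S" for cs
    using inferred.input[of "length cs" "cs @ [C]" F R] assms(2) by auto
qed

lemma derives_resolve_Pos:
  assumes "derives R F N K" "A \<in> K" "B \<in> K" "Pos x \<in> A" "Neg x \<in> B"
  shows "derives R F (Suc N) (insert ((A - {Pos x}) \<union> (B - {Neg x})) K)"
proof (rule derives_extend[OF assms(1)])
  fix cs
  assume valid: "\<forall>i < length cs. \<exists>S. inferred R F cs i S" and K: "K \<subseteq> set cs"
  let ?C = "(A - {Pos x}) \<union> (B - {Neg x})"
  obtain a b where ab: "a < length cs" "cs ! a = A" "b < length cs" "cs ! b = B"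
    using K assms(2,3) by (metis in_set_conv_nth subsetD)
  then obtain S T where "inferred R F cs a S" "inferred R F cs b T"
    using valid by blast
  then have "inferred R F (cs @ [?C]) a S" "inferred R F (cs @ [?C]) b T"
    by (auto intro: inferred_append)
  then have "inferred R F (cs @ [?C]) (length cs) (S \<union> T)"
    using ab assms(4,5) by (intro inferred.resolution[of _ _ a b _ _ S T x]) (simp_all add: nth_append)
  then show "\<exists>S. inferred R F (cs @ [?C]) (length cs) S" ..
qed

lemma derives_resolve:
  assumes "derives R F N K" "A \<in> K" "B \<in> K" "l \<in> A" "neg l \<in> B"
  shows "derives R F (Suc N) (insert ((A - {l}) \<union> (B - {neg l})) K)"
proof (cases l)
  case (Pos x)
  then show ?thesis
    using derives_resolve_Pos[of R F N K A B x] assms by simp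
next
  case (Neg x)
  then show ?thesis
    using derives_resolve_Pos[of R F N K B A x] assms by (simp add: Un_commute)
qed

lemma inferred_SRC_I_subset: "inferred SRC_I F cs i S \<Longrightarrow> S \<subseteq> F"
proof (induction rule: inferred.induct)
  case (symmetry i j S B \<phi>)
  then have "map_clauses \<phi> S \<subseteq> map_clauses \<phi> F"
    by (intro image_mono) simp
  moreover have "map_clauses \<phi> F = F"
    using symmetry.hyps by (auto simp: SRC_I_def)
  ultimately show ?case
    by simp
qed auto

lemma inferred_symmetry_snoc:
  assumes "\<forall>i < length cs. \<exists>S. inferred SRC_I F cs i S" "A \<in> set cs"
    and "is_symmetry \<phi>" "map_clauses \<phi> F = F"
  shows "\<exists>S. inferred SRC_I F (cs @ [\<phi> ` A]) (length cs) S"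
proof -
  obtain a where a: "a < length cs" "cs ! a = A"
    using assms(2) by (metis in_set_conv_nth)
  then obtain S where S: "inferred SRC_I F cs a S"
    using assms(1) by blast
  have "inferred SRC_I F (cs @ [\<phi> ` A]) (length cs) (map_clauses \<phi> S)"
    using a assms(3,4) inferred_append[OF S, of "[\<phi> ` A]"] inferred_SRC_I_subset[OF S]
    by (intro inferred.symmetry[of _ _ a _ _ S F \<phi>]) (simp_all add: nth_append SRC_I_def)
  then show ?thesis ..
qed

lemma derives_symmetry:
  assumes "derives SRC_I F N K" "A \<in> K" "is_symmetry \<phi>" "map_clauses \<phi> F = F"
  shows "derives SRC_I F (Suc N) (insert (\<phi> ` A) K)"
proof (rule derives_extend[OF assms(1)])
  fix cs
  assume "\<forall>i < length cs. \<exists>S. inferred SRC_I F cs i S" "K \<subseteq> set cs"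
  then show "\<exists>S. inferred SRC_I F (cs @ [\<phi> ` A]) (length cs) S"
    using assms(2-4) by (intro inferred_symmetry_snoc) auto
qed

text \<open>A loop rule: \<open>K'\<close> stands for \<open>K\<close> together with the members
  derived so far.\<close>

lemma derives_family:
  assumes "finite I" "derives R F N K"
    and step: "\<And>x N' K'. x \<in> I \<Longrightarrow> K \<subseteq> K' \<Longrightarrow> derives R F N' K' \<Longrightarrow>
      derives R F (N' + c) (insert (g x) K')"
  shows "derives R F (N + c * card I) (K \<union> g ` I)"
proof -
  have "derives R F (N + c * card J) (K \<union> g ` J)" if "finite J" "J \<subseteq> I" for J
    using that
  proof induction
    case empty
    then show ?case
      using assms(2) by simp
  next
    case (insert x J)
    then have "derives R F (N + c * card J + c) (insert (g x) (K \<union> g ` J))"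
      by (intro step) auto
    then show ?case
      using insert.hyps by (simp add: algebra_simps)
  qed
  then show ?thesis
    using assms(1) by simp
qed

lemma derives_inputs:
  assumes "finite F"
  shows "derives R F (card F) F"
proof -
  have "derives R F 0 {}"
    by (simp add: derives_def)
  then have "derives R F (0 + 1 * card F) ({} \<union> (\<lambda>C. C) ` F)"
    by (rule derives_family[OF assms]) (simp add: derives_input)
  then show ?thesis by simp
qed

text \<open>The last hypothesis keeps a side clause from reintroducing a literal that is resolved
  away.\<close>

lemma derives_hyperresolution:
  assumes "derives R F N K" "A \<in> K" "finite J" "inj_on l J"
    and "\<And>j. j \<in> J \<Longrightarrow> l j \<in> A \<and> B j \<in> K \<and> neg (l j) \<in> B j"
    and "\<And>j j'. j \<in> J \<Longrightarrow> j' \<in> J \<Longrightarrow> l j \<notin> B j'"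
  shows "derives R F (N + card J) (insert ((A - l ` J) \<union> (\<Union>j\<in>J. B j - {neg (l j)})) K)"
  using assms(3-6)
proof (induction J)
  case empty
  then show ?case
    using assms(1,2) by (simp add: insert_absorb)
next
  case (insert j J)
  let ?D = "(A - l ` J) \<union> (\<Union>j\<in>J. B j - {neg (l j)})"
  have IH: "derives R F (N + card J) (insert ?D K)"
    using insert.prems by (intro insert.IH) (auto simp: inj_on_def)
  have j: "l j \<notin> l ` J"
    using insert.prems(1) insert.hyps by auto
  have "derives R F (Suc (N + card J)) (insert ((?D - {l j}) \<union> (B j - {neg (l j)})) (insert ?D K))"
    using insert.prems(2)[of j] j by (intro derives_resolve[OF IH]) auto
  moreover have "(?D - {l j}) \<union> (B j - {neg (l j)}) =
      (A - l ` insert j J) \<union> (\<Union>j\<in>insert j J. B j - {neg (l j)})"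
    using insert.prems(3)[of j] by auto
  ultimately show ?case
    using insert.hyps by (auto elim: derives_mono)
qed

text \<open>The variable map \<open>h\<close> conjugated by the polarity. The sign of a literal on
  \<open>v\<close> flips exactly if \<open>s v\<close> and \<open>s (h v)\<close> differ, which
  needs complementary symmetries.\<close>

definition relabel :: "(nat \<Rightarrow> bool) \<Rightarrow> (nat \<Rightarrow> nat) \<Rightarrow> nat lit \<Rightarrow> nat lit" where
  "relabel s h l = (case l of
     Pos v \<Rightarrow> if s v then nlit s (h v) else plit s (h v) | Neg v \<Rightarrow> if s v then plit s (h v) else nlit s (h v))"

lemma relabel_simps [simp]:
  "relabel s h (plit s v) = plit s (h v)" "relabel s h (nlit s v) = nlit s (h v)"
  by (auto simp: relabel_def plit_def nlit_def)

text \<open>Padding variables move along with their hole; all hole clauses have equally many of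
  them, so images are inputs again.\<close>

definition swap_holes :: "nat \<Rightarrow> nat \<Rightarrow> nat \<Rightarrow> nat" where
  "swap_holes a b v = (case prod_decode v of (p, q) \<Rightarrow> case prod_decode q of (j, t) \<Rightarrow>
     prod_encode (p, prod_encode (transpose a b j, t)))"

lemma swap_holes_var [simp]: "swap_holes a b (var i k j t) = var i k (transpose a b j) t"
  by (simp add: swap_holes_def var_def)

lemma relabel_swap_involution [simp]:
  "relabel s (swap_holes a b) (relabel s (swap_holes a b) l) = l"
proof (cases l rule: lit_cases[where s = s])
  case (1 v)
  obtain i k j t where "v = var i k j t"
    by (rule var_cases)
  then show ?thesis
    using 1 by simp
next
  case (2 v)
  obtain i k j t where "v = var i k j t"
    by (rule var_cases)
  then show ?thesis
    using 2 by simp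
qed

lemma is_symmetry_relabel_swap: "is_symmetry (relabel s (swap_holes a b))"
  unfolding is_symmetry_def
proof (intro conjI allI)
  show "bij (relabel s (swap_holes a b))"
    by (rule involuntory_imp_bij) simp
  show "relabel s (swap_holes a b) (neg l) = neg (relabel s (swap_holes a b) l)" for l
    by (cases l rule: lit_cases[where s = s]) simp_all
qed

lemma map_clauses_padded_php:
  assumes "a < n" "b < n"
  shows "map_clauses (relabel s (swap_holes a b)) (padded_php s m n) = padded_php s m n"
proof -
  let ?\<phi> = "relabel s (swap_holes a b)"
  have less: "transpose a b j < n \<longleftrightarrow> j < n" for j
    using assms by (auto simp: transpose_def)
  have image_pigeon: "?\<phi> ` pigeon_clause s n i = pigeon_clause s n i" for i
  proof -
    have "?\<phi> ` pigeon_clause s n i = (\<lambda>j. plit s (X i j)) ` transpose a b ` {..<n}"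
      by (simp add: pigeon_clause_def image_image)
    also have "transpose a b ` {..<n} = {..<n}"
      using assms by (intro transpose_image_eq) simp
    finally show ?thesis
      by (simp add: pigeon_clause_def)
  qed
  have image_hole: "?\<phi> ` hole_clause s m (i, k, j) = hole_clause s m (i, k, transpose a b j)" for i k j
    by (simp add: hole_clause_def image_Un image_image)
  have sub: "map_clauses ?\<phi> (padded_php s m n) \<subseteq> padded_php s m n"
  proof (rule image_subsetI)
    fix C assume "C \<in> padded_php s m n"
    then show "?\<phi> ` C \<in> padded_php s m n"
    proof (cases rule: padded_php_cases)
      case (pigeon i)
      then show ?thesis
        by (simp add: image_pigeon padded_php_def)
    next
      case (hole i k j)
      then have "(i, k, transpose a b j) \<in> collisions n"
        using less by (simp add: collisions_def)
      then show ?thesis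
        using hole(4) by (simp add: image_hole padded_php_def)
    next
      case (unit i k j t)
      then have "{nlit s (var i k (transpose a b j) t)} \<in> pad_units s m n"
        using less by (intro pad_unitsI) simp_all
      then show ?thesis
        using unit(5) by (simp add: padded_php_def)
    qed
  qed
  \<comment> \<open>For an involution, mapping the inclusion once more gives its converse.\<close>
  have "map_clauses ?\<phi> (map_clauses ?\<phi> (padded_php s m n)) = padded_php s m n"
    by (simp add: image_image)
  then show ?thesis
    using sub image_mono[OF sub, of "\<lambda>C. ?\<phi> ` C"] by simp
qed

section \<open>Short derivation of the empty clause\<close>

definition clash_clause :: "(nat \<Rightarrow> bool) \<Rightarrow> nat \<times> nat \<times> nat \<Rightarrow> nat clause" where
  "clash_clause s = (\<lambda>(i, k, j). {nlit s (X i j), nlit s (X k j)})"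

definition diagonal :: "(nat \<Rightarrow> bool) \<Rightarrow> nat \<Rightarrow> nat clause" where
  "diagonal s k = (\<lambda>i. nlit s (X i i)) ` {..<k}"

lemma derives_clash_clauses:
  assumes "derives R (padded_php s m n) N (padded_php s m n)"
  shows "derives R (padded_php s m n) (N + m * card (collisions n))
     (padded_php s m n \<union> clash_clause s ` collisions n)"
proof (rule derives_family[OF finite_collisions assms])
  fix c N' K'
  assume c: "c \<in> collisions n" and K': "padded_php s m n \<subseteq> K'"
    and der: "derives R (padded_php s m n) N' K'"
  obtain i k j where ikj: "c = (i, k, j)" "i < k" "k \<le> n" "j < n"
    using c by (auto simp: collisions_def)
  define l where "l t = plit s (var i k j t)" for t
  have "hole_clause s m c \<in> K'"
    using c K' by (auto simp: padded_php_def)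
  moreover have "{neg (l t)} \<in> K'" if "t < m" for t
  proof -
    have "{neg (l t)} \<in> pad_units s m n"
      using c that unfolding pad_units_def l_def ikj by force
    then show ?thesis
      using K' by (auto simp: padded_php_def)
  qed
  ultimately have "derives R (padded_php s m n) (N' + card {..<m})
      (insert ((hole_clause s m c - l ` {..<m}) \<union> (\<Union>t\<in>{..<m}. {neg (l t)} - {neg (l t)})) K')"
    by (intro derives_hyperresolution[OF der]) (auto simp: l_def hole_clause_def ikj inj_on_def)
  moreover have "hole_clause s m c - l ` {..<m} = clash_clause s c"
    by (auto simp: hole_clause_def clash_clause_def ikj l_def)
  ultimately show "derives R (padded_php s m n) (N' + m) (insert (clash_clause s c) K')"
    by simp
qed

text \<open>
  If pigeons \<open>0, \<dots>, k\<close> cannot occupy holes \<open>0, \<dots>, k\<close> then, by symmetry, pigeon \<open>k\<close> has no hole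
  left once pigeons \<open>0, \<dots>, k - 1\<close> occupy holes \<open>0, \<dots>, k - 1\<close>.
\<close>

lemma derives_diagonal:
  assumes der: "derives SRC_I (padded_php s m n) N K"
    and K: "padded_php s m n \<union> clash_clause s ` collisions n \<subseteq> K"
    and k: "k \<le> n" "k < n \<Longrightarrow> diagonal s (Suc k) \<in> K"
  shows "derives SRC_I (padded_php s m n) (N + 2 * n) (insert (diagonal s k) K)"
proof -
  \<comment> \<open>For \<open>j \<ge> k\<close>, \<open>g j\<close> is the image of
    \<open>diagonal s (Suc k)\<close> when holes \<open>k\<close> and \<open>j\<close> are swapped;
    holes below \<open>k\<close> are excluded by clash clauses.\<close>
  define g where "g j = insert (nlit s (X k j)) (diagonal s k)" for j
  define l where "l j = plit s (X k j)" for j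
  define B where "B j = (if j < k then clash_clause s (j, k, j) else g j)" for j
  have der1: "derives SRC_I (padded_php s m n) (N + 1 * card {k..<n}) (K \<union> g ` {k..<n})"
  proof (rule derives_family[OF _ der])
    fix j N' K'
    assume j: "j \<in> {k..<n}" and K': "K \<subseteq> K'" and der': "derives SRC_I (padded_php s m n) N' K'"
    let ?\<phi> = "relabel s (swap_holes k j)"
    have "transpose k j i = i" if "i < k" for i
      using j that by (intro transpose_apply_other) auto
    then have "?\<phi> ` diagonal s (Suc k) = g j"
      by (simp add: diagonal_def g_def lessThan_Suc image_image)
    moreover have "derives SRC_I (padded_php s m n) (Suc N') (insert (?\<phi> ` diagonal s (Suc k)) K')"
      using j k K' by (intro derives_symmetry[OF der' _ is_symmetry_relabel_swap map_clauses_padded_php]) auto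
    ultimately show "derives SRC_I (padded_php s m n) (N' + 1) (insert (g j) K')"
      by simp
  qed simp
  have "derives SRC_I (padded_php s m n) (N + 1 * card {k..<n} + card {..<n})
      (insert ((pigeon_clause s n k - l ` {..<n}) \<union> (\<Union>j\<in>{..<n}. B j - {neg (l j)}))
        (K \<union> g ` {k..<n}))"
  proof (rule derives_hyperresolution[OF der1])
    show "pigeon_clause s n k \<in> K \<union> g ` {k..<n}"
      using K k by (auto simp: padded_php_def)
    show "l j \<in> pigeon_clause s n k \<and> B j \<in> K \<union> g ` {k..<n} \<and> neg (l j) \<in> B j" if "j \<in> {..<n}" for j
    proof (cases "j < k")
      case True
      then have "(j, k, j) \<in> collisions n"
        using that k by (simp add: collisions_def)
      then show ?thesis
        using True that K by (auto simp: B_def l_def pigeon_clause_def clash_clause_def)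
    next
      case False
      then show ?thesis
        using that by (auto simp: B_def l_def g_def pigeon_clause_def)
    qed
    show "l j \<notin> B j'" for j j'
      by (auto simp: l_def B_def clash_clause_def g_def diagonal_def)
  qed (auto simp: l_def inj_on_def)
  moreover have "(pigeon_clause s n k - l ` {..<n}) \<union> (\<Union>j\<in>{..<n}. B j - {neg (l j)}) = diagonal s k"
  proof -
    have "pigeon_clause s n k - l ` {..<n} = {}"
      by (auto simp: pigeon_clause_def l_def)
    moreover have "B j - {neg (l j)} = {nlit s (X j j)}" if "j < k" for j
      using that by (auto simp: B_def l_def clash_clause_def)
    moreover have "B j - {neg (l j)} = diagonal s k" if "\<not> j < k" for j
      using that by (auto simp: B_def l_def g_def diagonal_def)
    moreover have "(\<Union>j\<in>{..<n}. B j - {neg (l j)}) =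
        (\<Union>j\<in>{..<k}. B j - {neg (l j)}) \<union> (\<Union>j\<in>{k..<n}. B j - {neg (l j)})"
      using k(1) by (subst UN_Un[symmetric], subst ivl_disj_un) auto
    ultimately show ?thesis
      by (auto simp: diagonal_def)
  qed
  ultimately show ?thesis
    by (auto elim!: derives_mono)
qed

text \<open>Downward induction from \<open>diagonal s n\<close>, which needs no earlier diagonal
  clause, to \<open>diagonal s 0\<close>, which is empty.\<close>

lemma derives_empty:
  "derives SRC_I (padded_php s m n)
     (card (padded_php s m n) + m * card (collisions n) + (n + 1) * (2 * n)) {{}}"
proof -
  define K where "K = padded_php s m n \<union> clash_clause s ` collisions n"
  define N where "N = card (padded_php s m n) + m * card (collisions n)"
  have "finite (padded_php s m n)"
    using is_cnf_padded_php by (auto simp: is_cnf_def)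
  then have K: "derives SRC_I (padded_php s m n) N K"
    unfolding K_def N_def by (intro derives_clash_clauses derives_inputs)
  have "derives SRC_I (padded_php s m n) (N + (d + 1) * (2 * n)) (insert (diagonal s (n - d)) K)"
    if "d \<le> n" for d
    using that
  proof (induction d)
    case 0
    then show ?case
      using derives_diagonal[OF K, of n] by (simp add: K_def)
  next
    case (Suc d)
    then have "derives SRC_I (padded_php s m n) (N + (d + 1) * (2 * n) + 2 * n)
        (insert (diagonal s (n - Suc d)) (insert (diagonal s (n - d)) K))"
      by (intro derives_diagonal) (auto simp: K_def Suc_diff_Suc)
    then show ?case
      by (rule derives_mono) (auto simp: algebra_simps)
  qed
  from this[of n] show ?thesis
    by (rule derives_mono) (auto simp: N_def diagonal_def)
qed

text \<open>A final application of the identity symmetry moves the empty clause to the end.\<close>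

lemma shortest_proof_size_le:
  assumes "derives SRC_I F N {{}}"
  shows "shortest_proof_size SRC_I F \<le> enat (Suc N)"
proof -
  obtain cs where cs: "\<forall>i < length cs. \<exists>S. inferred SRC_I F cs i S" "length cs \<le> N" "{} \<in> set cs"
    using assms by (auto simp: derives_def)
  have "\<exists>S. inferred SRC_I F (cs @ [id ` {}]) (length cs) S"
    using cs by (intro inferred_symmetry_snoc) (auto simp: is_symmetry_def)
  then have "is_proof SRC_I F (cs @ [{}])"
    using inferred_snoc[OF cs(1)] by (simp add: is_proof_def)
  then have "shortest_proof_size SRC_I F \<le> enat (length (cs @ [{}]))"
    unfolding shortest_proof_size_def by (intro INF_lower) simp
  also have "\<dots> \<le> enat (Suc N)"
    using cs(2) by simp
  finally show ?thesis .
qed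

subsection \<open>The separation\<close>

lemma card_hard_php: "card (hard_php n) \<le> (n + 1) + (n + 1) ^ 3 + (n + 1) ^ 3 * (3 * (n + 1) ^ 3)"
proof -
  let ?s = "polarity n" and ?m = "3 * (n + 1) ^ 3"
  have "card (pigeon_clause ?s n ` {..n}) \<le> n + 1"
    using card_image_le[of "{..n}" "pigeon_clause ?s n"] by simp
  moreover have "card (hole_clause ?s ?m ` collisions n) \<le> (n + 1) ^ 3"
    using card_image_le[OF finite_collisions] card_collisions order_trans by blast
  moreover have "card (pad_units ?s ?m n) \<le> (n + 1) ^ 3 * ?m"
  proof -
    have "card (pad_units ?s ?m n) \<le> card (collisions n \<times> {..<?m})"
      unfolding pad_units_def by (intro card_image_le) simp
    also have "\<dots> = card (collisions n) * ?m"
      by (simp only: card_cartesian_product card_lessThan)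
    also have "\<dots> \<le> (n + 1) ^ 3 * ?m"
      using card_collisions by (rule mult_right_mono) simp
    finally show ?thesis .
  qed
  moreover have "card (hard_php n) \<le> card (pigeon_clause ?s n ` {..n}) +
      card (hole_clause ?s ?m ` collisions n) + card (pad_units ?s ?m n)"
    unfolding hard_php_def padded_php_def by (meson add_mono_thms_linordered_semiring(3) card_Un_le order_trans)
  ultimately show ?thesis by linarith
qed

lemma SRC_I_upper_bound:
  assumes "1 \<le> n"
  shows "shortest_proof_size SRC_I (hard_php n) \<le> enat (704 * n ^ 6)"
proof -
  define q where "q = (n + 1) ^ 3"
  have "derives SRC_I (hard_php n)
      (card (hard_php n) + 3 * q * card (collisions n) + (n + 1) * (2 * n)) {{}}"
    using derives_empty[of "polarity n" "3 * q" n] by (simp add: hard_php_def q_def)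
  then have "shortest_proof_size SRC_I (hard_php n) \<le>
      enat (Suc (card (hard_php n) + 3 * q * card (collisions n) + (n + 1) * (2 * n)))"
    by (rule shortest_proof_size_le)
  also have "Suc (card (hard_php n) + 3 * q * card (collisions n) + (n + 1) * (2 * n)) \<le> 704 * n ^ 6"
  proof -
    have 1: "n + 1 \<le> q"
      unfolding q_def by (rule self_le_power) auto
    have 2: "q \<le> q\<^sup>2"
      using 1 by (intro self_le_power) auto
    have 3: "(n + 1) * (2 * n) \<le> 2 * q\<^sup>2"
    proof -
      have "(n + 1) * (2 * n) \<le> q * (2 * q)"
        using 1 by (intro mult_mono) auto
      then show ?thesis
        by (simp add: power2_eq_square)
    qed
    have 4: "card (hard_php n) \<le> (n + 1) + q + 3 * q\<^sup>2"
      using card_hard_php[of n] unfolding q_def[symmetric] by (simp add: power2_eq_square)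
    have 5: "3 * q * card (collisions n) \<le> 3 * q\<^sup>2"
      using card_collisions[of n] unfolding q_def[symmetric] by (simp add: power2_eq_square)
    \<comment> \<open>Here 11 is \<open>1 + 1 + 1 + 3 + 3 + 2\<close>, as 1, \<open>n + 1\<close>
      and \<open>q\<close> are at most the square of \<open>q\<close>. With
      \<open>n + 1 \<le> 2 * n\<close> this gives \<open>704 = 11 * 2^6\<close>.\<close>
    have "Suc (card (hard_php n) + 3 * q * card (collisions n) + (n + 1) * (2 * n)) \<le> 11 * q\<^sup>2"
      using 1 2 3 4 5 by linarith
    also have "q\<^sup>2 = (n + 1) ^ 6"
      by (simp add: q_def flip: power_mult)
    also have "(n + 1) ^ 6 \<le> (2 * n) ^ 6"
      using assms by (intro power_mono) auto
    finally show ?thesis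
      by (simp add: power_mult_distrib)
  qed
  finally show ?thesis by simp
qed

text \<open>The 48 is \<open>8 * 6\<close>, from \<open>n \<le> 8 * k\<close> and
  \<open>2 \<le> (8/7)^6\<close>.\<close>

lemma exponential_bound:
  assumes "6 \<le> n"
  shows "2 powr (real n / 48) \<le> (8/7) ^ ((n + 1) div 4)"
proof -
  define k where "k = (n + 1) div 4"
  have "n \<le> 8 * k"
    using assms by (simp add: k_def)
  have "(2::real) powr (real n / 48) \<le> 2 powr (real k / 6)"
    using \<open>n \<le> 8 * k\<close> by (intro powr_mono) auto
  also have "\<dots> \<le> ((8/7) powr 6) powr (real k / 6)"
    by (intro powr_mono2) (simp_all add: powr_numeral power_divide)
  also have "\<dots> = (8/7) powr real k"
    by (simp only: powr_powr) simp
  also have "\<dots> = (8/7) ^ k"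
    by (simp add: powr_realpow)
  finally show ?thesis
    by (simp add: k_def)
qed

theorem corollary40:
  "\<exists>\<tau> :: nat \<Rightarrow> nat cnf.
     (\<forall>n. is_cnf (\<tau> n) \<and> unsatisfiable (\<tau> n)) \<and>
     (\<exists>c k :: nat. \<forall>\<^sub>F n in sequentially.
        shortest_proof_size SRC_I (\<tau> n) \<le> enat (c * n ^ k)) \<and>
     (\<exists>\<delta> > 0 :: real. \<forall>\<^sub>F n in sequentially.
        ereal (2 powr (\<delta> * real n)) \<le> ereal_of_enat (shortest_proof_size SR_II (\<tau> n)))"
proof (intro exI[of _ hard_php] conjI allI)
  show "is_cnf (hard_php n)" "unsatisfiable (hard_php n)" for n
    by (simp_all add: hard_php_def is_cnf_padded_php unsatisfiable_padded_php)
  have "\<forall>\<^sub>F n in sequentially. shortest_proof_size SRC_I (hard_php n) \<le> enat (704 * n ^ 6)"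
    using SRC_I_upper_bound by (intro eventually_sequentiallyI[of 1])
  then show "\<exists>c k. \<forall>\<^sub>F n in sequentially. shortest_proof_size SRC_I (hard_php n) \<le> enat (c * n ^ k)"
    by blast
  have "ereal (2 powr (1 / 48 * real n)) \<le> ereal_of_enat (shortest_proof_size SR_II (hard_php n))"
    if n: "6 \<le> n" for n
  proof (cases "shortest_proof_size SR_II (hard_php n)")
    case (enat N)
    \<comment> \<open>A finite infimum is attained by an actual proof.\<close>
    have "{cs. is_proof SR_II (hard_php n) cs} \<noteq> {}"
    proof
      assume "{cs. is_proof SR_II (hard_php n) cs} = {}"
      then have "shortest_proof_size SR_II (hard_php n) = top"
        unfolding shortest_proof_size_def by (simp only: image_empty Inf_empty)
      then show False
        using enat by (simp add: top_enat_def)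
    qed
    then have "shortest_proof_size SR_II (hard_php n) \<in>
        (\<lambda>cs. enat (length cs)) ` {cs. is_proof SR_II (hard_php n) cs}"
      unfolding shortest_proof_size_def by (metis (mono_tags) ex_in_conv image_is_empty wellorder_InfI)
    then obtain cs where cs: "is_proof SR_II (hard_php n) cs" "N = length cs"
      using enat by auto
    then have "2 powr (1 / 48 * real n) \<le> real N"
      using SR_II_lower_bound[of n cs] exponential_bound[OF n] n by simp
    then show ?thesis
      by (simp add: enat)
  qed simp
  then have "\<forall>\<^sub>F n in sequentially.
      ereal (2 powr (1 / 48 * real n)) \<le> ereal_of_enat (shortest_proof_size SR_II (hard_php n))"
    by (intro eventually_sequentiallyI[of 6])
  then show "\<exists>\<delta>>0. \<forall>\<^sub>F n in sequentially.
      ereal (2 powr (\<delta> * real n)) \<le> ereal_of_enat (shortest_proof_size SR_II (hard_php n))"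
    by (intro exI[of _ "1 / 48"]) simp
qed

end
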